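(* Let $K\subset\mathbb{R}^3$ be a strictly convex body with $C^2$-boundary and positive Gaussian curvature on $\partial K$. Fix $\nu\in\mathbb{S}^2$ and choose an oriented orthonormal basis $\{e_1,e_2\}$ of $\nu^\perp$. Let $m=\min_{x\in K}x\cdot\nu$, $M=\max_{x\in K}x\cdot\nu$, and $u(\theta)=\cos\theta\,e_1+\sin\theta\,e_2$. Define $$F(\theta,\lambda):=h_K\bigl(u(\theta)+\lambda\nu\bigr),$$ and for $p\in(m,M)$ write the slicing support function of $K$ as $$H(\theta,p)=h_\nu(u(\theta),p)=\inf_{\lambda\in\mathbb{R}}\bigl(F(\theta,\lambda)-\lambda p\bigr).$$ For each $(\theta,p)\in\mathbb{S}^1\times(m,M)$, let $\lambda=\lambda(\theta,p)$ denote the unique minimizer in this infimum. Then the Monge-Ampère-type operator $$\mathcal{A}[H]:=\det\begin{pmatrix}H_{\theta\theta}+H & H_{\theta p}\\ H_{\theta p} & H_{pp}\end{pmatrix}=(H_{\theta\theta}+H)H_{pp}-(H_{\theta p})^2$$ satisfies $$\mathcal{A}[H]=-\frac{F_{\theta\theta}+F-\lambda F_\lambda}{F_{\lambda\lambda}}=-\frac{F_{\theta\theta}+F-\lambda p}{F_{\lambda\lambda}},$$ where $F$ and all its derivatives are evaluated at $(\theta,\lambda(\theta,p))$. Moreover, $\mathcal{A}[H]<0$ for all $(\theta,p)\in\mathbb{S}^1\times(m,M)$.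
   Context: The support function is $h_K(v)=\sup_{x\in K}x\cdot v$, $v\in\mathbb{R}^3$. For $\nu\in\mathbb{S}^2$ write $\nu^\perp=\{x\in\mathbb{R}^3:x\cdot\nu=0\}$. The slicing support function is $h_\nu(u,p)=\sup\{x\cdot u: x\in K,\ x\cdot\nu=p\}$ for $u\in\nu^\perp$, $p\in\mathbb{R}$ (with value $-\infty$ if the slice is empty). Subscripts denote partial derivatives with respect to the indicated variables. Here $\theta$ is the angular coordinate on $\mathbb{S}^1$, so functions of $\theta$ are $2\pi$-periodic. *)

theory Defs
  imports "HOL-Analysis.Analysis"
begin

definition C2_on :: "'a::real_normed_vector set \<Rightarrow> ('a \<Rightarrow> 'b::real_normed_vector) \<Rightarrow> bool" where
  "C2_on U f \<longleftrightarrow>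
     (\<exists>(f' :: 'a \<Rightarrow> 'a \<Rightarrow>\<^sub>L 'b) (f'' :: 'a \<Rightarrow> 'a \<Rightarrow>\<^sub>L ('a \<Rightarrow>\<^sub>L 'b)).
        (\<forall>x\<in>U. (f has_derivative blinfun_apply (f' x)) (at x)) \<and>
        (\<forall>x\<in>U. (f' has_derivative blinfun_apply (f'' x)) (at x)) \<and>
        continuous_on U f'')"


definition convex_body :: "'a::euclidean_space set \<Rightarrow> bool" where
  "convex_body K \<longleftrightarrow> convex K \<and> compact K \<and> interior K \<noteq> {}"

definition strictly_convex_body :: "'a::euclidean_space set \<Rightarrow> bool" where
  "strictly_convex_body K \<longleftrightarrow>
     convex_body K \<and> (\<forall>x\<in>K. \<forall>y\<in>K. x \<noteq> y \<longrightarrow> open_segment x y \<subseteq> interior K)"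


definition chart_D1 :: "(real^2 \<Rightarrow> real^3) \<Rightarrow> real^2 \<Rightarrow> real^3" where
  "chart_D1 \<phi> w = frechet_derivative \<phi> (at w) (axis 1 1)"

definition chart_D2 :: "(real^2 \<Rightarrow> real^3) \<Rightarrow> real^2 \<Rightarrow> real^3" where
  "chart_D2 \<phi> w = frechet_derivative \<phi> (at w) (axis 2 1)"

definition C2_chart :: "(real^3) set \<Rightarrow> (real^2) set \<Rightarrow> (real^2 \<Rightarrow> real^3) \<Rightarrow> bool" where
  "C2_chart S U \<phi> \<longleftrightarrow>
     open U \<and> C2_on U \<phi> \<and>
     openin (top_of_set S) (\<phi> ` U) \<and>
     (\<exists>\<psi>. homeomorphism U (\<phi> ` U) \<phi> \<psi>) \<and>
     (\<forall>w\<in>U. cross3 (chart_D1 \<phi> w) (chart_D2 \<phi> w) \<noteq> 0)"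

definition C2_surface :: "(real^3) set \<Rightarrow> bool" where
  "C2_surface S \<longleftrightarrow> (\<forall>x\<in>S. \<exists>U \<phi>. C2_chart S U \<phi> \<and> x \<in> \<phi> ` U)"

definition chart_normal :: "(real^2 \<Rightarrow> real^3) \<Rightarrow> real^2 \<Rightarrow> real^3" where
  "chart_normal \<phi> w = sgn (cross3 (chart_D1 \<phi> w) (chart_D2 \<phi> w))"

definition first_fundamental_form :: "(real^2 \<Rightarrow> real^3) \<Rightarrow> real^2 \<Rightarrow> real^2^2" where
  "first_fundamental_form \<phi> w = vector
     [vector [chart_D1 \<phi> w \<bullet> chart_D1 \<phi> w, chart_D1 \<phi> w \<bullet> chart_D2 \<phi> w],
      vector [chart_D1 \<phi> w \<bullet> chart_D2 \<phi> w, chart_D2 \<phi> w \<bullet> chart_D2 \<phi> w]]"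

definition second_fundamental_form :: "(real^2 \<Rightarrow> real^3) \<Rightarrow> real^2 \<Rightarrow> real^2^2" where
  "second_fundamental_form \<phi> w = vector
     [vector [chart_D1 (chart_D1 \<phi>) w \<bullet> chart_normal \<phi> w,
              chart_D2 (chart_D1 \<phi>) w \<bullet> chart_normal \<phi> w],
      vector [chart_D2 (chart_D1 \<phi>) w \<bullet> chart_normal \<phi> w,
              chart_D2 (chart_D2 \<phi>) w \<bullet> chart_normal \<phi> w]]"

definition chart_curvature :: "(real^2 \<Rightarrow> real^3) \<Rightarrow> real^2 \<Rightarrow> real" where
  "chart_curvature \<phi> w =
     det (second_fundamental_form \<phi> w) / det (first_fundamental_form \<phi> w)"

text \<open>The value of \<^term>\<open>chart_curvature \<phi> w\<close> depends only on the point \<^term>\<open>\<phi> w\<close>, not on the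
  chart around it, so the choice operator below picks the common value.\<close>

definition gaussian_curvature :: "(real^3) set \<Rightarrow> real^3 \<Rightarrow> real" where
  "gaussian_curvature S x =
     (SOME k. \<exists>U \<phi> w. C2_chart S U \<phi> \<and> w \<in> U \<and> \<phi> w = x \<and> k = chart_curvature \<phi> w)"


definition support_function :: "'a::euclidean_space set \<Rightarrow> 'a \<Rightarrow> real" where
  "support_function K v = (SUP x\<in>K. x \<bullet> v)"

text \<open>Extended-real valued: the supremum over an empty slice is \<^term>\<open>-\<infinity> :: ereal\<close>.\<close>

definition slicing_support_function ::
    "'a::euclidean_space set \<Rightarrow> 'a \<Rightarrow> 'a \<Rightarrow> real \<Rightarrow> ereal" where
  "slicing_support_function K \<nu> u p = (SUP x\<in>{x\<in>K. x \<bullet> \<nu> = p}. ereal (x \<bullet> u))"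


definition pd1 :: "(real \<Rightarrow> real \<Rightarrow> real) \<Rightarrow> real \<Rightarrow> real \<Rightarrow> real" where
  "pd1 f s t = deriv (\<lambda>s'. f s' t) s"

definition pd2 :: "(real \<Rightarrow> real \<Rightarrow> real) \<Rightarrow> real \<Rightarrow> real \<Rightarrow> real" where
  "pd2 f s t = deriv (\<lambda>t'. f s t') t"

definition monge_ampere_op :: "(real \<Rightarrow> real \<Rightarrow> real) \<Rightarrow> real \<Rightarrow> real \<Rightarrow> real" where
  "monge_ampere_op H \<theta> p = det (vector
     [vector [pd1 (pd1 H) \<theta> p + H \<theta> p, pd2 (pd1 H) \<theta> p],
      vector [pd2 (pd1 H) \<theta> p, pd2 (pd2 H) \<theta> p]] :: real^2^2)"

end

theory Submission
  imports Defs
begin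

text \<open>
  Let \<open>x(v)\<close> be the unique point of \<open>K\<close> maximising \<open>x \<bullet> v\<close>; then \<open>\<nabla>h\<^sub>K(v) = x(v)\<close>. In a chart \<open>\<phi>\<close> around
  \<open>x(v)\<close>, the parameter \<open>w\<close> of \<open>x(v)\<close> solves \<open>\<partial>\<^sub>i\<phi>(w) \<bullet> v = 0\<close>, a system whose Jacobian in \<open>w\<close> is the
  second fundamental form scaled by \<open>\<bar>v\<bar>\<close>. It is invertible by positive curvature, so \<open>x\<close> is continuously
  differentiable, with a symmetric derivative that is positive definite transversally to \<open>v\<close>: it is
  nonnegative because \<open>x\<close> is a monotone map, and nondegenerate because the second fundamental form is.
  Hence \<open>F\<close> is \<open>C\<^sup>2\<close> with \<open>F\<^sub>\<lambda>\<^sub>\<lambda> > 0\<close> and \<open>F\<^sub>\<theta>\<^sub>\<theta> + F - \<lambda> F\<^sub>\<lambda> = D x(u') \<bullet> u' > 0\<close>. The minimiser \<open>\<lambda>(\<theta>, p)\<close> solves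
  \<open>F\<^sub>\<lambda> = p\<close>, the maximiser \<open>x(u + \<lambda>\<nu>)\<close> lies in the slice at height \<open>p\<close>, and implicit differentiation gives
  \<open>H\<^sub>\<theta> = F\<^sub>\<theta>\<close>, \<open>H\<^sub>p = -\<lambda>\<close>, \<open>\<lambda>\<^sub>p = 1 / F\<^sub>\<lambda>\<^sub>\<lambda>\<close> and \<open>\<lambda>\<^sub>\<theta> = -F\<^sub>\<theta>\<^sub>\<lambda> / F\<^sub>\<lambda>\<^sub>\<lambda>\<close>.
\<close>

section \<open>Second derivatives and implicit differentiation\<close>

text \<open>The mean value theorem applied twice: first in \<open>s\<close> to the increment of
  \<open>f\<close> along \<open>b\<close>, then in \<open>t\<close> to the resulting increment of
  \<open>fa\<close>. The left-hand side is symmetric in \<open>a\<close> and \<open>b\<close>, while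
  the right-hand side depends on the order of differentiation.\<close>

lemma mixed_second_difference:
  fixes f :: "'a::real_normed_vector \<Rightarrow> real"
  assumes "h > 0"
    and fa: "\<And>s t. \<lbrakk>0 \<le> s; s \<le> h; 0 \<le> t; t \<le> h\<rbrakk> \<Longrightarrow>
      ((\<lambda>s. f (x + s *\<^sub>R a + t *\<^sub>R b)) has_real_derivative fa (x + s *\<^sub>R a + t *\<^sub>R b)) (at s)"
    and fab: "\<And>s t. \<lbrakk>0 \<le> s; s \<le> h; 0 \<le> t; t \<le> h\<rbrakk> \<Longrightarrow>
      ((\<lambda>t. fa (x + s *\<^sub>R a + t *\<^sub>R b)) has_real_derivative fab (x + s *\<^sub>R a + t *\<^sub>R b)) (at t)"
  obtains s t where "0 < s" "s < h" "0 < t" "t < h"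
    "f (x + h *\<^sub>R a + h *\<^sub>R b) - f (x + h *\<^sub>R a) - f (x + h *\<^sub>R b) + f x
      = h\<^sup>2 * fab (x + s *\<^sub>R a + t *\<^sub>R b)"
proof -
  let ?g = "\<lambda>s. f (x + s *\<^sub>R a + h *\<^sub>R b) - f (x + s *\<^sub>R a + 0 *\<^sub>R b)"
  have "(?g has_real_derivative (fa (x + s *\<^sub>R a + h *\<^sub>R b) - fa (x + s *\<^sub>R a + 0 *\<^sub>R b))) (at s)"
    if "0 \<le> s" "s \<le> h" for s
    using that \<open>h > 0\<close> by (intro DERIV_diff fa) auto
  from MVT2[OF \<open>h > 0\<close> this] obtain s where s: "0 < s" "s < h"
    "?g h - ?g 0 = (h - 0) * (fa (x + s *\<^sub>R a + h *\<^sub>R b) - fa (x + s *\<^sub>R a + 0 *\<^sub>R b))"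
    by auto
  from MVT2[OF \<open>h > 0\<close> fab[of s]] s obtain t where t: "0 < t" "t < h"
    "fa (x + s *\<^sub>R a + h *\<^sub>R b) - fa (x + s *\<^sub>R a + 0 *\<^sub>R b) = (h - 0) * fab (x + s *\<^sub>R a + t *\<^sub>R b)"
    by auto
  show ?thesis
    using s(3) unfolding t(3) by (intro that[OF s(1,2) t(1,2)]) (simp add: power2_eq_square)
qed

text \<open>Pairing with a fixed vector \<open>v\<close> reduces the claim to real functions. The
  second difference over a square of side \<open>h\<close> equals \<open>h\<^sup>2\<close> times
  either mixed derivative, each taken at some point near \<open>x\<close>; as \<open>h\<close>
  shrinks, continuity at \<open>x\<close> makes the two agree. With \<open>v\<close> chosen as the
  difference of the two sides, agreement means \<open>v \<bullet> v = 0\<close>.\<close>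

lemma symmetric_second_derivative:
  fixes f :: "'a::real_normed_vector \<Rightarrow> 'b::real_inner"
  assumes U: "open U" "x \<in> U"
    and f': "\<And>y. y \<in> U \<Longrightarrow> (f has_derivative blinfun_apply (f' y)) (at y)"
    and f'': "\<And>y. y \<in> U \<Longrightarrow> (f' has_derivative blinfun_apply (f'' y)) (at y)"
    and cont: "continuous_on U f''"
  shows "f'' x a b = f'' x b a"
proof -
  define v where "v = f'' x a b - f'' x b a"
  define T where "T = (\<lambda>a b y. f'' y b a \<bullet> v)"
  have T: "isCont (T a b) x" for a b
  proof -
    have "isCont f'' x" using cont U by (simp add: continuous_on_eq_continuous_at)
    then show ?thesis unfolding T_def by (intro continuous_intros)
  qed
  have mvt: "\<exists>d>0. \<forall>h. 0 < h \<and> h < d \<longrightarrow> (\<exists>z. norm (z - x) < r \<and>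
     (f (x + h *\<^sub>R a + h *\<^sub>R b) - f (x + h *\<^sub>R a) - f (x + h *\<^sub>R b) + f x) \<bullet> v = h\<^sup>2 * T a b z)"
    if "r > 0" for r a b
  proof -
    obtain e where e: "e > 0" "ball x e \<subseteq> U" using U openE by blast
    \<comment> \<open>Steps of length below \<open>r' / N\<close> keep the square inside
      \<open>U\<close> and within distance \<open>r\<close> of \<open>x\<close>. The summand 1 in
      \<open>N\<close> keeps it positive when \<open>a\<close> and \<open>b\<close> both
      vanish.\<close>
    define r' where "r' = min e r"
    define N where "N = norm a + norm b + 1"
    have N: "N > 0" by (simp add: N_def add_nonneg_pos)
    have small: "norm (s *\<^sub>R a + t *\<^sub>R b) < r'" if "0 \<le> s" "s \<le> h" "0 \<le> t" "t \<le> h" "h < r' / N" for s t h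
    proof -
      have "norm (s *\<^sub>R a + t *\<^sub>R b) \<le> s * norm a + t * norm b"
        using norm_triangle_ineq[of "s *\<^sub>R a" "t *\<^sub>R b"] that by simp
      also have "\<dots> \<le> h * norm a + h * norm b"
        using that by (intro add_mono mult_right_mono) auto
      also have "\<dots> \<le> h * N" using that by (simp add: N_def algebra_simps)
      also have "\<dots> < r'" using that N by (simp add: field_simps)
      finally show ?thesis .
    qed
    have "\<exists>z. norm (z - x) < r \<and>
     (f (x + h *\<^sub>R a + h *\<^sub>R b) - f (x + h *\<^sub>R a) - f (x + h *\<^sub>R b) + f x) \<bullet> v = h\<^sup>2 * T a b z"
      if h: "0 < h" "h < r' / N" for h
    proof -
      have inU: "x + s *\<^sub>R a + t *\<^sub>R b \<in> U" if "0 \<le> s" "s \<le> h" "0 \<le> t" "t \<le> h" for s t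
      proof -
        have "dist x (x + s *\<^sub>R a + t *\<^sub>R b) < e"
          using small[OF that h(2)] norm_minus_cancel[of "s *\<^sub>R a + t *\<^sub>R b"]
          by (simp add: dist_norm r'_def algebra_simps)
        then show ?thesis using e by auto
      qed
      obtain s t where st: "0 < s" "s < h" "0 < t" "t < h"
        "f (x + h *\<^sub>R a + h *\<^sub>R b) \<bullet> v - f (x + h *\<^sub>R a) \<bullet> v - f (x + h *\<^sub>R b) \<bullet> v + f x \<bullet> v
          = h\<^sup>2 * T a b (x + s *\<^sub>R a + t *\<^sub>R b)"
      proof (rule mixed_second_difference[where f="\<lambda>y. f y \<bullet> v" and fa="\<lambda>y. f' y a \<bullet> v" and fab = "T a b" and a=a and b=b and x=x, OF h(1)])
        fix s t assume st: "0 \<le> s" "s \<le> h" "0 \<le> t" "t \<le> h"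
        note inU = inU[OF st]
        show "((\<lambda>s. f (x + s *\<^sub>R a + t *\<^sub>R b) \<bullet> v) has_real_derivative f' (x + s *\<^sub>R a + t *\<^sub>R b) a \<bullet> v) (at s)"
          unfolding has_field_derivative_def
          by (rule has_derivative_eq_rhs, (rule derivative_intros has_derivative_compose[where g=f and f="\<lambda>s. x + s *\<^sub>R a + t *\<^sub>R b", OF _ f'[OF inU]])+)
            (auto simp: blinfun.scaleR_right)
        show "((\<lambda>t. f' (x + s *\<^sub>R a + t *\<^sub>R b) a \<bullet> v) has_real_derivative T a b (x + s *\<^sub>R a + t *\<^sub>R b)) (at t)"
          unfolding has_field_derivative_def T_def
          by (rule has_derivative_eq_rhs, (rule derivative_intros has_derivative_compose[where g=f' and f="\<lambda>t. x + s *\<^sub>R a + t *\<^sub>R b", OF _ f''[OF inU]])+)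
            (auto simp: blinfun.scaleR_right blinfun.scaleR_left)
      qed
      have "norm (s *\<^sub>R a + t *\<^sub>R b) < r" using small[of s h t] st h(2) by (auto simp: r'_def)
      then show ?thesis using st(5) by (intro exI[of _ "x + s *\<^sub>R a + t *\<^sub>R b"]) (simp add: inner_simps add.assoc)
    qed
    moreover have "r' / N > 0" using N e that by (auto simp: r'_def)
    ultimately show ?thesis by blast
  qed
  have "T a b x = T b a x"
  proof (rule ccontr)
    assume ne: "T a b x \<noteq> T b a x"
    \<comment> \<open>Half the gap: the common value found for small \<open>h\<close> would have to
      lie within less than this of both \<open>T a b x\<close> and \<open>T b a x\<close>.\<close>
    define \<epsilon> where "\<epsilon> = \<bar>T a b x - T b a x\<bar> / 2"
    have "\<epsilon> > 0" using ne by (simp add: \<epsilon>_def)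
    have "\<exists>r>0. \<forall>z. norm (z - x) < r \<longrightarrow> \<bar>T p q z - T p q x\<bar> < \<epsilon>" for p q
      using T[of p q] \<open>\<epsilon> > 0\<close> unfolding continuous_at_eps_delta by (auto simp: dist_norm)
    then obtain r1 r2 where r: "r1 > 0" "\<And>z. norm (z - x) < r1 \<Longrightarrow> \<bar>T a b z - T a b x\<bar> < \<epsilon>"
      "r2 > 0" "\<And>z. norm (z - x) < r2 \<Longrightarrow> \<bar>T b a z - T b a x\<bar> < \<epsilon>" by metis
    obtain d1 where d1: "d1 > 0" "\<And>h. \<lbrakk>0 < h; h < d1\<rbrakk> \<Longrightarrow> (\<exists>z. norm (z - x) < r1 \<and>
     (f (x + h *\<^sub>R a + h *\<^sub>R b) - f (x + h *\<^sub>R a) - f (x + h *\<^sub>R b) + f x) \<bullet> v = h\<^sup>2 * T a b z)"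
      using mvt[OF r(1)] by meson
    obtain d2 where d2: "d2 > 0" "\<And>h. \<lbrakk>0 < h; h < d2\<rbrakk> \<Longrightarrow> (\<exists>z. norm (z - x) < r2 \<and>
     (f (x + h *\<^sub>R b + h *\<^sub>R a) - f (x + h *\<^sub>R b) - f (x + h *\<^sub>R a) + f x) \<bullet> v = h\<^sup>2 * T b a z)"
      using mvt[OF r(3)] by meson
    define h where "h = min d1 d2 / 2"
    have h: "0 < h" "h < d1" "h < d2" using d1 d2 by (auto simp: h_def)
    obtain z1 where z1: "norm (z1 - x) < r1"
      "(f (x + h *\<^sub>R a + h *\<^sub>R b) - f (x + h *\<^sub>R a) - f (x + h *\<^sub>R b) + f x) \<bullet> v = h\<^sup>2 * T a b z1"
      using d1 h by blast
    obtain z2 where z2: "norm (z2 - x) < r2"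
      "(f (x + h *\<^sub>R b + h *\<^sub>R a) - f (x + h *\<^sub>R b) - f (x + h *\<^sub>R a) + f x) \<bullet> v = h\<^sup>2 * T b a z2"
      using d2 h by blast
    have "h\<^sup>2 * T a b z1 = h\<^sup>2 * T b a z2"
      unfolding z1(2)[symmetric] z2(2)[symmetric] by (simp add: algebra_simps)
    then have "T a b z1 = T b a z2" using h by simp
    moreover note r(2)[OF z1(1)] r(4)[OF z2(1)]
    moreover have "2 * \<epsilon> = \<bar>T a b x - T b a x\<bar>" by (simp add: \<epsilon>_def)
    ultimately show False by linarith
  qed
  then have "v \<bullet> v = 0" unfolding T_def v_def by (simp add: inner_simps)
  then show ?thesis by (simp add: v_def)
qed

text \<open>The differentiation half of the implicit function theorem, for a solution branch
  \<open>w\<close> already known to be continuous. With \<open>a\<close> and \<open>b\<close> the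
  increments of \<open>w\<close> and of its argument, constancy of \<open>G\<close> gives that
  \<open>A a + B b\<close> is small against \<open>norm a + norm b\<close>. Applying
  \<open>A'\<close> bounds \<open>a + A' (B b)\<close> in the same way, and the share of
  \<open>norm a\<close> is absorbed on the left.\<close>

lemma implicit_function_has_derivative:
  fixes G :: "'a::real_normed_vector \<times> 'b::real_normed_vector \<Rightarrow> 'c::real_normed_vector"
    and w :: "'b \<Rightarrow> 'a"
  assumes G: "(G has_derivative (\<lambda>z. A (fst z) + B (snd z))) (at (w y, y))"
    and A': "bounded_linear A'" and B: "bounded_linear B" and inv: "\<And>a. A' (A a) = a"
    and cont: "isCont w y"
    and zero: "eventually (\<lambda>z. G (w z, z) = G (w y, y)) (nhds y)"
  shows "(w has_derivative (\<lambda>b. - A' (B b))) (at y)"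
  unfolding has_derivative_at_alt
proof (intro conjI allI impI)
  interpret A': bounded_linear A' by fact
  have lin: "bounded_linear (\<lambda>b. A' (B b))" using A' B by (rule bounded_linear_compose)
  then show "bounded_linear (\<lambda>b. - A' (B b))" by (rule bounded_linear_minus)
  obtain C1 where C1: "C1 > 0" "\<And>c. norm (A' c) \<le> norm c * C1"
    using A'.pos_bounded by blast
  obtain C2 where C2: "C2 > 0" "\<And>b. norm (A' (B b)) \<le> norm b * C2"
    using bounded_linear.pos_bounded[OF lin] by blast
  fix e :: real assume "e > 0"
  \<comment> \<open>The first bound gives \<open>C1 * \<epsilon> \<le> 1 / 2\<close>, so that half
    of \<open>norm a\<close> can be absorbed. This leads to
    \<open>norm a + norm b \<le> (2 * C2 + 2) * norm b\<close>, and the second bound then brings the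
    error down to \<open>e * norm b\<close>.\<close>
  define \<epsilon> where "\<epsilon> = min (1 / (2 * C1)) (e / (C1 * (2 * C2 + 2)))"
  have \<epsilon>: "\<epsilon> > 0" "C1 * \<epsilon> \<le> 1 / 2" "C1 * \<epsilon> * (2 * C2 + 2) \<le> e"
  proof -
    show "\<epsilon> > 0" using C1 C2 \<open>e > 0\<close> by (auto simp: \<epsilon>_def)
    have "\<epsilon> \<le> 1 / (2 * C1)" "\<epsilon> \<le> e / (C1 * (2 * C2 + 2))" by (auto simp: \<epsilon>_def)
    moreover have "C1 * (2 * C2 + 2) > 0" using C1 C2 by simp
    ultimately show "C1 * \<epsilon> \<le> 1 / 2" "C1 * \<epsilon> * (2 * C2 + 2) \<le> e"
      using C1 by (simp_all add: pos_le_divide_eq mult_ac)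
  qed
  obtain d where d: "d > 0" "\<And>p. norm (p - (w y, y)) < d \<Longrightarrow>
      norm (G p - G (w y, y) - (A (fst (p - (w y, y))) + B (snd (p - (w y, y)))))
        \<le> \<epsilon> * norm (p - (w y, y))"
    using G \<epsilon>(1) unfolding has_derivative_at_alt by blast
  obtain d1 where d1: "d1 > 0" "\<And>z. norm (z - y) < d1 \<Longrightarrow> norm (w z - w y) < d / 2"
    using cont[unfolded continuous_at_eps_delta, rule_format, of "d / 2"] d(1) by (auto simp: dist_norm)
  obtain d2 where d2: "d2 > 0" "\<And>z. norm (z - y) < d2 \<Longrightarrow> G (w z, z) = G (w y, y)"
    using zero unfolding eventually_nhds_metric dist_norm by blast
  show "\<exists>d>0. \<forall>z. norm (z - y) < d \<longrightarrow> norm (w z - w y - - A' (B (z - y))) \<le> e * norm (z - y)"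
  proof (intro exI[of _ "min (d / 2) (min d1 d2)"] conjI allI impI)
    show "0 < min (d / 2) (min d1 d2)" using d(1) d1(1) d2(1) by simp
    fix z assume z: "norm (z - y) < min (d / 2) (min d1 d2)"
    define a b where "a = w z - w y" and "b = z - y"
    have ab: "norm (a, b) \<le> norm a + norm b"
      by (rule norm_Pair_le)
    have "norm a < d / 2" "norm b < d / 2" using z d1(2)[of z] by (auto simp: a_def b_def)
    then have "norm ((w z, z) - (w y, y)) < d" using ab by (simp add: a_def b_def)
    from d(2)[OF this] have "norm (A a + B b) \<le> \<epsilon> * norm (a, b)"
      using d2(2)[of z] z norm_minus_cancel[of "A a + B b"] by (simp add: a_def b_def del: norm_minus_cancel)
    then have "norm (A a + B b) \<le> \<epsilon> * (norm a + norm b)"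
      using ab \<epsilon>(1) by (smt (verit) mult_left_mono)
    then have "norm (A a + B b) * C1 \<le> \<epsilon> * (norm a + norm b) * C1"
      using C1(1) by (intro mult_right_mono) auto
    moreover have "a + A' (B b) = A' (A a + B b)" by (simp add: A'.add inv)
    ultimately have main: "norm (a + A' (B b)) \<le> C1 * \<epsilon> * (norm a + norm b)"
      using C1(2)[of "A a + B b"] by (simp add: mult.commute mult.left_commute)
    have "norm a \<le> norm (a + A' (B b)) + norm (A' (B b))"
      using norm_triangle_ineq4[of "a + A' (B b)" "A' (B b)"] by simp
    also have "\<dots> \<le> 1 / 2 * (norm a + norm b) + norm b * C2"
      using main C2(2)[of b] mult_right_mono[OF \<epsilon>(2) add_nonneg_nonneg[OF norm_ge_zero[of a] norm_ge_zero[of b]]]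
      by linarith
    finally have "norm a + norm b \<le> (2 * C2 + 2) * norm b" by (simp add: field_simps)
    then have "C1 * \<epsilon> * (norm a + norm b) \<le> C1 * \<epsilon> * ((2 * C2 + 2) * norm b)"
      using C1 \<epsilon>(1) by (intro mult_left_mono) auto
    also have "\<dots> \<le> e * norm b"
      using mult_right_mono[OF \<epsilon>(3), of "norm b"] by (simp add: mult.assoc)
    finally show "norm (w z - w y - - A' (B (z - y))) \<le> e * norm (z - y)"
      using main by (simp add: a_def b_def)
  qed
qed

section \<open>Second derivatives of functions of two real variables\<close>

lemma C2_on_prodI:
  fixes f f1 f2 :: "real \<times> real \<Rightarrow> real"
  assumes f: "\<And>x. x \<in> U \<Longrightarrow> (f has_derivative (\<lambda>h. f1 x * fst h + f2 x * snd h)) (at x)"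
    and f1: "\<And>x. x \<in> U \<Longrightarrow> (f1 has_derivative (\<lambda>h. f11 x * fst h + f12 x * snd h)) (at x)"
    and f2: "\<And>x. x \<in> U \<Longrightarrow> (f2 has_derivative (\<lambda>h. f21 x * fst h + f22 x * snd h)) (at x)"
    and cont: "continuous_on U f11" "continuous_on U f12" "continuous_on U f21" "continuous_on U f22"
  shows "C2_on U f"
proof -
  \<comment> \<open>Derivatives in \<open>C2_on\<close> are bounded linear maps, so the partials
    have to be repackaged: \<open>E1\<close> and \<open>E2\<close> are the coordinate functionals,
    and the rank one maps \<open>T i j\<close> built from them carry the four second
    partials.\<close>
  define E1 E2 :: "(real \<times> real) \<Rightarrow>\<^sub>L real" where "E1 = Blinfun fst" and "E2 = Blinfun snd"
  have E [simp]: "blinfun_apply E1 = fst" "blinfun_apply E2 = snd"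
    by (simp_all add: E1_def E2_def bounded_linear_Blinfun_apply bounded_linear_fst bounded_linear_snd)
  define T where "T = (\<lambda>(i :: (real \<times> real) \<Rightarrow>\<^sub>L real) (j :: (real \<times> real) \<Rightarrow>\<^sub>L real). Blinfun (\<lambda>h. i h *\<^sub>R j))"
  have T [simp]: "blinfun_apply (T i j) h = i h *\<^sub>R j" for i j h
    unfolding T_def by (subst bounded_linear_Blinfun_apply) (auto intro: bounded_linear_intros blinfun.bounded_linear_right)
  show ?thesis
    unfolding C2_on_def
  proof (intro exI conjI ballI)
    let ?f' = "\<lambda>x. f1 x *\<^sub>R E1 + f2 x *\<^sub>R E2"
    let ?f'' = "\<lambda>x. f11 x *\<^sub>R T E1 E1 + f12 x *\<^sub>R T E2 E1 + f21 x *\<^sub>R T E1 E2 + f22 x *\<^sub>R T E2 E2"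
    show "continuous_on U ?f''" by (intro continuous_intros cont)
    fix x assume x: "x \<in> U"
    show "(f has_derivative blinfun_apply (?f' x)) (at x)"
      by (rule has_derivative_eq_rhs[OF f[OF x]]) (auto simp: fun_eq_iff blinfun.add_left blinfun.scaleR_left)
    have "(?f' has_derivative (\<lambda>h. (f11 x * fst h + f12 x * snd h) *\<^sub>R E1 + (f21 x * fst h + f22 x * snd h) *\<^sub>R E2)) (at x)"
      by (intro derivative_intros f1[OF x] f2[OF x])
    then show "(?f' has_derivative blinfun_apply (?f'' x)) (at x)"
      by (rule has_derivative_eq_rhs)
        (auto simp: fun_eq_iff blinfun.add_left blinfun.scaleR_left scaleR_add_left)
  qed
qed

lemma partial_derivatives_curried:
  fixes f :: "real \<Rightarrow> real \<Rightarrow> real"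
  assumes "(case_prod f has_derivative (\<lambda>h. a * fst h + b * snd h)) (at (s, t))"
  shows "((\<lambda>s. f s t) has_real_derivative a) (at s)" "((\<lambda>t. f s t) has_real_derivative b) (at t)"
    and "pd1 f s t = a" "pd2 f s t = b"
proof -
  have "((\<lambda>s. case_prod f (s, t)) has_derivative (\<lambda>h. a * fst (h, 0::real) + b * snd (h, 0::real))) (at s)"
    by (rule has_derivative_compose[where g="case_prod f" and f="\<lambda>s. (s, t)", OF _ assms]) (intro derivative_intros)
  then show 1: "((\<lambda>s. f s t) has_real_derivative a) (at s)"
    by (simp add: has_field_derivative_def)
  have "((\<lambda>t. case_prod f (s, t)) has_derivative (\<lambda>h. a * fst (0::real, h) + b * snd (0::real, h))) (at t)"
    by (rule has_derivative_compose[where g="case_prod f" and f="\<lambda>t. (s, t)", OF _ assms]) (intro derivative_intros)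
  then show 2: "((\<lambda>t. f s t) has_real_derivative b) (at t)"
    by (simp add: has_field_derivative_def)
  show "pd1 f s t = a" "pd2 f s t = b" unfolding pd1_def pd2_def by (rule DERIV_imp_deriv 1 2)+
qed

text \<open>The first partials are known only on \<open>U\<close>, which for \<open>H\<close> is the
  strip over the open interval of admissible heights. Openness of \<open>U\<close> allows
  \<open>pd1 f\<close> and \<open>pd2 f\<close> to be replaced by \<open>f1\<close> and
  \<open>f2\<close> before differentiating again.\<close>

lemma second_partial_derivatives:
  fixes f f1 f2 :: "real \<Rightarrow> real \<Rightarrow> real"
  assumes U: "open U" "(s, t) \<in> U"
    and f: "\<And>s t. (s, t) \<in> U \<Longrightarrow> (case_prod f has_derivative (\<lambda>h. f1 s t * fst h + f2 s t * snd h)) (at (s, t))"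
    and f1: "(case_prod f1 has_derivative (\<lambda>h. f11 * fst h + f12 * snd h)) (at (s, t))"
    and f2: "(case_prod f2 has_derivative (\<lambda>h. f21 * fst h + f22 * snd h)) (at (s, t))"
  shows "pd1 (pd1 f) s t = f11" "pd2 (pd1 f) s t = f12" "pd2 (pd2 f) s t = f22"
proof -
  have "(case_prod (pd1 f) has_derivative (\<lambda>h. f11 * fst h + f12 * snd h)) (at (s, t))"
    by (rule has_derivative_transform_within_open[OF f1 U]) (auto simp: partial_derivatives_curried(3)[OF f])
  then show "pd1 (pd1 f) s t = f11" "pd2 (pd1 f) s t = f12" by (rule partial_derivatives_curried)+
  have "(case_prod (pd2 f) has_derivative (\<lambda>h. f21 * fst h + f22 * snd h)) (at (s, t))"
    by (rule has_derivative_transform_within_open[OF f2 U]) (auto simp: partial_derivatives_curried(4)[OF f])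
  then show "pd2 (pd2 f) s t = f22" by (rule partial_derivatives_curried)
qed

section \<open>The support point\<close>

text \<open>For a strictly convex body and nonzero \<open>v\<close> the maximiser is unique, and
  this is the inverse Gauss map, constant along rays. It will be the gradient of the support
  function.\<close>

definition support_point :: "'a::euclidean_space set \<Rightarrow> 'a \<Rightarrow> 'a" where
  "support_point K v = (SOME x. x \<in> K \<and> (\<forall>z\<in>K. z \<bullet> v \<le> x \<bullet> v))"

lemma convex_bodyD:
  assumes "convex_body K"
  shows "compact K" "K \<noteq> {}" "closed K"
  using assms by (auto simp: convex_body_def compact_imp_closed)

lemma support_point:
  assumes "convex_body K"
  shows "support_point K v \<in> K" "z \<in> K \<Longrightarrow> z \<bullet> v \<le> support_point K v \<bullet> v"
proof -
  have "\<exists>x\<in>K. \<forall>z\<in>K. z \<bullet> v \<le> x \<bullet> v"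
    using convex_bodyD[OF assms] by (intro continuous_attains_sup) (auto intro!: continuous_intros)
  then have "support_point K v \<in> K \<and> (\<forall>z\<in>K. z \<bullet> v \<le> support_point K v \<bullet> v)"
    unfolding support_point_def Bex_def by (rule someI_ex)
  then show "support_point K v \<in> K" "z \<in> K \<Longrightarrow> z \<bullet> v \<le> support_point K v \<bullet> v" by auto
qed

lemma interior_not_maximal:
  fixes c v :: "'a::real_inner"
  assumes "c \<in> interior K" "v \<noteq> 0"
  obtains z where "z \<in> K" "c \<bullet> v < z \<bullet> v"
proof -
  obtain e where e: "e > 0" "cball c e \<subseteq> K" using assms(1) mem_interior_cball by blast
  let ?z = "c + (e / norm v) *\<^sub>R v"
  have "?z \<in> K" using e assms(2) by (intro subsetD[OF e(2)]) (simp add: dist_norm)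
  moreover have "(e / norm v) * (v \<bullet> v) > 0" using e assms(2) by simp
  ultimately show ?thesis by (intro that[of ?z]) (auto simp: inner_simps)
qed

text \<open>Two distinct maximisers would have a midpoint in the interior with the same value, and
  an interior point can always be beaten by moving in direction \<open>v\<close>.\<close>

lemma support_point_unique:
  assumes K: "strictly_convex_body K" and "v \<noteq> 0" and y: "y \<in> K" "\<And>z. z \<in> K \<Longrightarrow> z \<bullet> v \<le> y \<bullet> v"
  shows "y = support_point K v"
proof (rule ccontr)
  have cb: "convex_body K" using K by (simp add: strictly_convex_body_def)
  let ?x = "support_point K v"
  assume "y \<noteq> ?x"
  then have "open_segment y ?x \<subseteq> interior K" "midpoint y ?x \<in> open_segment y ?x"
    using K y support_point(1)[OF cb] by (auto simp: strictly_convex_body_def)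
  then obtain z where z: "z \<in> K" "midpoint y ?x \<bullet> v < z \<bullet> v"
    using interior_not_maximal[OF _ \<open>v \<noteq> 0\<close>] by blast
  have "y \<bullet> v = ?x \<bullet> v"
    using y(2)[OF support_point(1)[OF cb]] support_point(2)[OF cb y(1)] by (rule antisym[rotated])
  then have "midpoint y ?x \<bullet> v = y \<bullet> v" by (simp add: midpoint_def inner_simps)
  then show False using z y(2)[OF z(1)] by simp
qed

lemma support_point_frontier:
  assumes K: "convex_body K" and "v \<noteq> 0"
  shows "support_point K v \<in> frontier K"
proof -
  have "support_point K v \<notin> interior K"
  proof
    assume "support_point K v \<in> interior K"
    from interior_not_maximal[OF this \<open>v \<noteq> 0\<close>] obtain z
      where "z \<in> K" "support_point K v \<bullet> v < z \<bullet> v" .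
    then show False using support_point(2)[OF K, of z v] by simp
  qed
  then show ?thesis
    using support_point(1)[OF K] closure_subset[of K] by (auto simp: frontier_def)
qed

lemma support_function_eq:
  assumes "convex_body K"
  shows "support_function K v = support_point K v \<bullet> v"
  unfolding support_function_def
proof (rule cSup_eq_maximum)
  show "support_point K v \<bullet> v \<in> (\<lambda>x. x \<bullet> v) ` K" by (rule imageI) (rule support_point(1)[OF assms])
  show "y \<le> support_point K v \<bullet> v" if y: "y \<in> (\<lambda>x. x \<bullet> v) ` K" for y
  proof -
    from y obtain z where "z \<in> K" "y = z \<bullet> v" by blast
    then show ?thesis using support_point(2)[OF assms, of z v] by simp
  qed
qed

text \<open>A map into a compact set is continuous once its graph is closed. By uniqueness of the
  maximiser, the graph is cut out by the closed conditions that each \<open>z\<close> in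
  \<open>K\<close> does no better.\<close>

lemma continuous_on_support_point:
  assumes K: "strictly_convex_body K"
  shows "continuous_on (- {0}) (support_point K)"
proof -
  have cb: "convex_body K" using K by (simp add: strictly_convex_body_def)
  have graph: "(\<lambda>v. (v, support_point K v)) ` (- {0}) = ((- {0}) \<times> K) \<inter> (\<Inter>z\<in>K. {p. z \<bullet> fst p \<le> snd p \<bullet> fst p})"
  proof (intro set_eqI iffI)
    fix p assume "p \<in> ((- {0}) \<times> K) \<inter> (\<Inter>z\<in>K. {p. z \<bullet> fst p \<le> snd p \<bullet> fst p})"
    then have "fst p \<noteq> 0" "snd p = support_point K (fst p)"
      by (auto intro: support_point_unique[OF K])
    then show "p \<in> (\<lambda>v. (v, support_point K v)) ` (- {0})"
      by (intro image_eqI[of _ _ "fst p"]) (auto simp: prod_eq_iff)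
  qed (auto intro: support_point[OF cb])
  have "closed (\<Inter>z\<in>K. {p. z \<bullet> fst p \<le> snd p \<bullet> fst p})"
    by (intro closed_INT ballI closed_Collect_le continuous_intros)
  then show ?thesis
    by (subst continuous_closed_graph_eq[OF convex_bodyD(1)[OF cb]])
      (auto simp: graph intro: closedin_closed_Int support_point[OF cb])
qed

lemma isCont_support_point:
  assumes "strictly_convex_body K" "v \<noteq> 0"
  shows "isCont (support_point K) v"
  using continuous_on_support_point[OF assms(1)] assms(2)
  by (simp add: continuous_on_eq_continuous_at open_Compl)

text \<open>Maximality at \<open>v\<close> and at \<open>y\<close> squeezes the linearisation error
  between 0 and the inner product of \<open>support_point K y - support_point K v\<close> with
  \<open>y - v\<close>. Continuity of the support point makes the upper bound small compared with
  \<open>norm (y - v)\<close>.\<close>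

lemma has_derivative_support_function:
  assumes K: "strictly_convex_body K" and "v \<noteq> 0"
  shows "(support_function K has_derivative (\<lambda>b. support_point K v \<bullet> b)) (at v)"
  unfolding has_derivative_at_alt
proof (intro conjI allI impI)
  have cb: "convex_body K" using K by (simp add: strictly_convex_body_def)
  show "bounded_linear (\<lambda>b. support_point K v \<bullet> b)" by (rule bounded_linear_inner_right)
  fix e :: real assume "e > 0"
  then obtain d where d: "d > 0" "\<And>y. norm (y - v) < d \<Longrightarrow> norm (support_point K y - support_point K v) < e"
    using isCont_support_point[OF assms] unfolding continuous_at_eps_delta dist_norm by blast
  show "\<exists>d>0. \<forall>y. norm (y - v) < d \<longrightarrow>
      norm (support_function K y - support_function K v - support_point K v \<bullet> (y - v)) \<le> e * norm (y - v)"
  proof (intro exI[of _ d] conjI allI impI d(1))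
    fix y assume y: "norm (y - v) < d"
    let ?x = "support_point K"
    have "?x v \<bullet> y \<le> ?x y \<bullet> y" "?x y \<bullet> v \<le> ?x v \<bullet> v"
      using support_point[OF cb] by auto
    then have "0 \<le> support_function K y - support_function K v - ?x v \<bullet> (y - v)"
      "support_function K y - support_function K v - ?x v \<bullet> (y - v) \<le> (?x y - ?x v) \<bullet> (y - v)"
      by (simp_all add: support_function_eq[OF cb] inner_simps)
    moreover have "(?x y - ?x v) \<bullet> (y - v) \<le> norm (?x y - ?x v) * norm (y - v)"
      by (rule norm_cauchy_schwarz)
    moreover have "norm (?x y - ?x v) * norm (y - v) \<le> e * norm (y - v)"
      using d(2)[OF y] by (intro mult_right_mono) auto
    ultimately show "norm (support_function K y - support_function K v - ?x v \<bullet> (y - v)) \<le> e * norm (y - v)"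
      by simp
  qed
qed

lemma support_point_monotone:
  assumes "convex_body K"
  shows "0 \<le> (support_point K v - support_point K w) \<bullet> (v - w)"
  using support_point(2)[OF assms support_point(1)[OF assms], of w v]
    support_point(2)[OF assms support_point(1)[OF assms], of v w]
  by (simp add: inner_simps)

text \<open>By monotonicity of the support point, its component along \<open>b\<close> is a
  nondecreasing function on the line through \<open>v\<close> in direction \<open>b\<close>;
  \<open>D b \<bullet> b\<close> is the derivative of that function at 0.\<close>

lemma derivative_support_point_nonneg:
  assumes "convex_body K" and D: "(support_point K has_derivative D) (at v)"
  shows "0 \<le> D b \<bullet> b"
proof -
  let ?f = "\<lambda>t. support_point K (v + t *\<^sub>R b) \<bullet> b"
  have "(?f has_derivative (\<lambda>t. D (t *\<^sub>R b) \<bullet> b)) (at 0)"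
    by (rule derivative_intros has_derivative_compose[where g="support_point K" and f="\<lambda>t. v + t *\<^sub>R b"])+
      (use D in \<open>auto intro!: derivative_eq_intros\<close>)
  moreover have "D (t *\<^sub>R b) = t *\<^sub>R D b" for t
    using has_derivative_linear[OF D] by (simp add: linear_cmul)
  ultimately have der: "(?f has_real_derivative D b \<bullet> b) (at 0)"
    by (simp add: has_field_derivative_def mult.commute[of _ "D b \<bullet> b"])
  have "mono_on UNIV ?f"
  proof (rule mono_onI)
    fix r s :: real assume "r \<le> s"
    show "?f r \<le> ?f s"
    proof (cases "r = s")
      case False
      have "0 \<le> (s - r) * (?f s - ?f r)"
        using support_point_monotone[OF assms(1), of "v + s *\<^sub>R b" "v + r *\<^sub>R b"]
        by (simp add: inner_simps algebra_simps)
      then show ?thesis using False \<open>r \<le> s\<close> by (simp add: zero_le_mult_iff)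
    qed simp
  qed
  then show ?thesis by (rule mono_on_imp_deriv_nonneg[OF _ der]) simp
qed

section \<open>Charts of positive curvature\<close>

text \<open>Translates the operator form of \<open>C2_on\<close> into partial derivatives of the
  chart. Symmetry of the second derivative lets \<open>chart_D2 (chart_D1 \<phi>)\<close> serve as
  the mixed derivative in both expansions, matching the off-diagonal entries of
  \<open>second_fundamental_form\<close>.\<close>

lemma C2_chart_derivatives:
  assumes chart: "C2_chart S U \<phi>" and w: "w \<in> U"
  shows "(\<phi> has_derivative (\<lambda>a. a $ 1 *\<^sub>R chart_D1 \<phi> w + a $ 2 *\<^sub>R chart_D2 \<phi> w)) (at w)" (is ?th1)
    and "(chart_D1 \<phi> has_derivative
      (\<lambda>a. a $ 1 *\<^sub>R chart_D1 (chart_D1 \<phi>) w + a $ 2 *\<^sub>R chart_D2 (chart_D1 \<phi>) w)) (at w)" (is ?th2)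
    and "(chart_D2 \<phi> has_derivative
      (\<lambda>a. a $ 1 *\<^sub>R chart_D2 (chart_D1 \<phi>) w + a $ 2 *\<^sub>R chart_D2 (chart_D2 \<phi>) w)) (at w)" (is ?th3)
    and "isCont (chart_D1 (chart_D1 \<phi>)) w" (is ?th4)
    and "isCont (chart_D2 (chart_D1 \<phi>)) w" (is ?th5)
    and "isCont (chart_D2 (chart_D2 \<phi>)) w" (is ?th6)
proof -
  have U: "open U" using chart by (simp add: C2_chart_def)
  obtain f' f'' where f': "\<And>y. y \<in> U \<Longrightarrow> (\<phi> has_derivative blinfun_apply (f' y)) (at y)"
    and f'': "\<And>y. y \<in> U \<Longrightarrow> (f' has_derivative blinfun_apply (f'' y)) (at y)"
    and cont: "continuous_on U f''"
    using chart unfolding C2_chart_def C2_on_def by blast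
  have sym: "f'' y a b = f'' y b a" if "y \<in> U" for y a b
    by (rule symmetric_second_derivative[OF U that f' f'' cont])
  let ?e1 = "axis 1 1 :: real^2" and ?e2 = "axis 2 1 :: real^2"
  have expand: "a = a $ 1 *\<^sub>R ?e1 + a $ 2 *\<^sub>R ?e2" for a
    by (simp add: vec_eq_iff forall_2 axis_def)
  have D: "frechet_derivative \<phi> (at y) = f' y" if "y \<in> U" for y
    using frechet_derivative_at[OF f'[OF that]] by simp
  have der: "((\<lambda>y. frechet_derivative \<phi> (at y) c) has_derivative (\<lambda>a. f'' y a c)) (at y)" if y: "y \<in> U" for y c
  proof -
    have "((\<lambda>y. f' y c) has_derivative (\<lambda>a. f'' y a c)) (at y)"
      by (rule bounded_linear.has_derivative[OF blinfun.bounded_linear_left f''[OF y]])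
    then show ?thesis
      by (rule has_derivative_transform_within_open[OF _ U y]) (simp add: D)
  qed
  have D12: "(chart_D1 \<phi> has_derivative (\<lambda>a. f'' y a ?e1)) (at y)"
    "(chart_D2 \<phi> has_derivative (\<lambda>a. f'' y a ?e2)) (at y)" if "y \<in> U" for y
    using der[OF that, of ?e1] der[OF that, of ?e2] by (simp_all add: chart_D1_def[abs_def] chart_D2_def[abs_def])
  note D1 = D12(1) and D2 = D12(2)
  have second: "chart_D1 (chart_D1 \<phi>) y = f'' y ?e1 ?e1" "chart_D2 (chart_D1 \<phi>) y = f'' y ?e2 ?e1"
    "chart_D2 (chart_D2 \<phi>) y = f'' y ?e2 ?e2" if y: "y \<in> U" for y
    unfolding chart_D1_def[of "chart_D1 \<phi>"] chart_D2_def[of "chart_D1 \<phi>"] chart_D2_def[of "chart_D2 \<phi>"]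
      frechet_derivative_at[OF D1[OF y], symmetric] frechet_derivative_at[OF D2[OF y], symmetric]
    by (rule refl)+
  show ?th1
  proof (rule has_derivative_eq_rhs[OF f'[OF w]], rule ext)
    show "f' w a = a $ 1 *\<^sub>R chart_D1 \<phi> w + a $ 2 *\<^sub>R chart_D2 \<phi> w" for a
      unfolding chart_D1_def chart_D2_def D[OF w]
      by (subst expand[of a]) (simp only: blinfun.add_right blinfun.scaleR_right)
  qed
  show ?th2
  proof (rule has_derivative_eq_rhs[OF D1[OF w]], rule ext)
    show "f'' w a ?e1 = a $ 1 *\<^sub>R chart_D1 (chart_D1 \<phi>) w + a $ 2 *\<^sub>R chart_D2 (chart_D1 \<phi>) w" for a
      unfolding second[OF w]
      by (subst expand[of a]) (simp only: blinfun.add_right blinfun.scaleR_right blinfun.add_left blinfun.scaleR_left)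
  qed
  show ?th3
  proof (rule has_derivative_eq_rhs[OF D2[OF w]], rule ext)
    show "f'' w a ?e2 = a $ 1 *\<^sub>R chart_D2 (chart_D1 \<phi>) w + a $ 2 *\<^sub>R chart_D2 (chart_D2 \<phi>) w" for a
      unfolding second[OF w] sym[OF w, of ?e2 ?e1]
      by (subst expand[of a]) (simp only: blinfun.add_right blinfun.scaleR_right blinfun.add_left blinfun.scaleR_left)
  qed
  have c: "isCont g w" if "\<And>y. y \<in> U \<Longrightarrow> g y = f'' y a b" for g :: "real^2 \<Rightarrow> real^3" and a b
  proof -
    have "continuous_on U (\<lambda>y. f'' y a b)" by (intro continuous_intros cont)
    then have "continuous_on U g" using that by simp
    then show ?thesis using U w by (simp add: continuous_on_eq_continuous_at)
  qed
  show ?th4 ?th5 ?th6 by (rule c, erule second)+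
qed

text \<open>The denominator of the curvature is nonnegative by Cauchy-Schwarz, so a positive
  quotient forces a positive determinant of the second fundamental form.\<close>

lemma chart_curvature_pos:
  assumes "chart_curvature \<phi> w > 0"
  defines "n \<equiv> chart_normal \<phi> w"
  shows "(chart_D2 (chart_D1 \<phi>) w \<bullet> n)\<^sup>2 < (chart_D1 (chart_D1 \<phi>) w \<bullet> n) * (chart_D2 (chart_D2 \<phi>) w \<bullet> n)"
proof -
  have "0 \<le> det (first_fundamental_form \<phi> w)"
    using Cauchy_Schwarz_ineq[of "chart_D1 \<phi> w" "chart_D2 \<phi> w"]
    by (simp add: first_fundamental_form_def det_2 power2_eq_square)
  then have "0 < det (second_fundamental_form \<phi> w)"
    using assms(1) unfolding chart_curvature_def by (auto simp: zero_less_divide_iff)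
  then show ?thesis by (simp add: second_fundamental_form_def det_2 power2_eq_square n_def)
qed

text \<open>The choice operator in the curvature yields the value of \<^emph>\<open>some\<close> chart around the point.\<close>

lemma gaussian_curvature_pos_chart:
  assumes "C2_surface S" "x \<in> S" "gaussian_curvature S x > 0"
  obtains U \<phi> w where "C2_chart S U \<phi>" "w \<in> U" "\<phi> w = x" "chart_curvature \<phi> w > 0"
proof -
  let ?P = "\<lambda>k. \<exists>U \<phi> w. C2_chart S U \<phi> \<and> w \<in> U \<and> \<phi> w = x \<and> k = chart_curvature \<phi> w"
  have "\<exists>k. ?P k" using assms(1,2) unfolding C2_surface_def by fast
  then have "?P (gaussian_curvature S x)" unfolding gaussian_curvature_def by (rule someI_ex)
  then show ?thesis using that assms(3) by auto
qed

text \<open>Lagrange's identity gives that the cross product of \<open>v\<close> and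
  \<open>n\<close> vanishes; expanding a further product with \<open>n\<close> yields the relation,
  which is kept free of division.\<close>

lemma orthogonal_cross3_parallel:
  fixes p q v :: "real^3"
  assumes "p \<bullet> v = 0" "q \<bullet> v = 0"
  defines "n \<equiv> cross3 p q"
  shows "(n \<bullet> n) *\<^sub>R v = (n \<bullet> v) *\<^sub>R n"
proof -
  have "cross3 v n = 0"
    using assms(1,2) by (simp add: n_def Lagrange inner_commute)
  then have "cross3 n (cross3 v n) = 0" by simp
  then show ?thesis by (simp add: Lagrange inner_commute)
qed

section \<open>Continuous differentiability of the support point\<close>

lemma continuous_on_compose_isCont:
  assumes "continuous_on V w" "w ` V \<subseteq> U" "\<And>y. y \<in> U \<Longrightarrow> isCont g y"
  shows "continuous_on V (\<lambda>v. g (w v))"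
  by (rule continuous_on_compose2[OF continuous_at_imp_continuous_on assms(1,2)]) (use assms(3) in blast)

text \<open>\<open>p\<close> and \<open>q\<close> are the chart's tangent vectors at the support
  point of \<open>v\<close>; \<open>L\<close>, \<open>M\<close>, \<open>N\<close> are the second
  derivatives of the chart paired with \<open>v\<close> itself instead of the unit normal. The
  derivative is minus the inverse of the symmetric matrix with these entries, applied to the pair
  \<open>p v \<bullet> b\<close>, \<open>q v \<bullet> b\<close> and pushed forward by the chart.
  The explicit formula makes continuity and symmetry visible.\<close>

lemma support_point_local:
  assumes K: "strictly_convex_body K" and S: "C2_surface (frontier K)"
    and curv: "\<And>x. x \<in> frontier K \<Longrightarrow> gaussian_curvature (frontier K) x > 0"
    and v0: "v0 \<noteq> 0"
  obtains V and p q :: "real^3 \<Rightarrow> real^3" and L M N :: "real^3 \<Rightarrow> real"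
  where "open V" "v0 \<in> V" "0 \<notin> V"
    and "continuous_on V p" "continuous_on V q" "continuous_on V L" "continuous_on V M" "continuous_on V N"
    and "\<forall>v\<in>V. (M v)\<^sup>2 < L v * N v"
    and "\<forall>v\<in>V. p v \<bullet> v = 0 \<and> q v \<bullet> v = 0 \<and> cross3 (p v) (q v) \<noteq> 0"
    and "\<forall>v\<in>V. (support_point K has_derivative
          (\<lambda>b. - (1 / (L v * N v - (M v)\<^sup>2)) *\<^sub>R
              ((N v * (p v \<bullet> b) - M v * (q v \<bullet> b)) *\<^sub>R p v +
               (L v * (q v \<bullet> b) - M v * (p v \<bullet> b)) *\<^sub>R q v))) (at v)"
proof -
  let ?x = "support_point K"
  have cb: "convex_body K" using K by (simp add: strictly_convex_body_def)
  have x0: "?x v0 \<in> frontier K" by (rule support_point_frontier[OF cb v0])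
  obtain U \<phi> w0 where chart: "C2_chart (frontier K) U \<phi>" and w0: "w0 \<in> U" "\<phi> w0 = ?x v0"
    and pos: "chart_curvature \<phi> w0 > 0"
    by (rule gaussian_curvature_pos_chart[OF S x0 curv[OF x0]])
  have U: "open U" and op: "openin (top_of_set (frontier K)) (\<phi> ` U)"
    and cross: "\<And>w. w \<in> U \<Longrightarrow> cross3 (chart_D1 \<phi> w) (chart_D2 \<phi> w) \<noteq> 0"
    using chart by (auto simp: C2_chart_def)
  obtain \<psi> where "homeomorphism U (\<phi> ` U) \<phi> \<psi>" using chart by (auto simp: C2_chart_def)
  then have \<psi>: "continuous_on (\<phi> ` U) \<psi>" "\<And>w. w \<in> U \<Longrightarrow> \<psi> (\<phi> w) = w"
    by (auto simp: homeomorphism_def)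
  obtain T where T: "open T" "\<phi> ` U = frontier K \<inter> T" using op by (auto simp: openin_open)
  \<comment> \<open>The nonzero directions whose support point falls in the chart; \<open>T\<close>
    witnesses that the chart image is relatively open in the frontier.\<close>
  define V0 where "V0 = (- {0}) \<inter> ?x -` T"
  have V0: "open V0" unfolding V0_def
    by (rule continuous_open_preimage[OF continuous_on_support_point[OF K] _ T(1)]) (simp add: open_Compl)
  have xV0: "?x v \<in> \<phi> ` U" if "v \<in> V0" for v
    using that support_point_frontier[OF cb] by (auto simp: V0_def T(2))
  define w where "w = (\<lambda>v. \<psi> (?x v))"
  have wU: "w v \<in> U" and \<phi>w: "\<phi> (w v) = ?x v" if "v \<in> V0" for v
    using xV0[OF that] by (auto simp: w_def \<psi>(2))
  have contw: "continuous_on V0 w"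
    unfolding w_def
  proof (rule continuous_on_compose2[OF \<psi>(1)])
    show "continuous_on V0 ?x"
      by (rule continuous_on_subset[OF continuous_on_support_point[OF K]]) (auto simp: V0_def)
    show "?x ` V0 \<subseteq> \<phi> ` U" using xV0 by blast
  qed
  note der = C2_chart_derivatives[OF chart]
  define p q where "p = (\<lambda>v. chart_D1 \<phi> (w v))" and "q = (\<lambda>v. chart_D2 \<phi> (w v))"
  define r s t where "r = chart_D1 (chart_D1 \<phi>)" and "s = chart_D2 (chart_D1 \<phi>)"
    and "t = chart_D2 (chart_D2 \<phi>)"
  define L M N where "L = (\<lambda>v. r (w v) \<bullet> v)" and "M = (\<lambda>v. s (w v) \<bullet> v)" and "N = (\<lambda>v. t (w v) \<bullet> v)"
  have comp: "continuous_on V0 (\<lambda>v. g (w v))" if "\<And>y. y \<in> U \<Longrightarrow> isCont g y" for g :: "real^2 \<Rightarrow> real^3"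
    by (rule continuous_on_compose_isCont[OF contw _ that]) (use wU in auto)
  have cont: "continuous_on V0 p" "continuous_on V0 q" "continuous_on V0 L" "continuous_on V0 M" "continuous_on V0 N"
    unfolding p_def q_def L_def M_def N_def r_def s_def t_def
    by (intro continuous_intros comp der has_derivative_continuous[OF der(2)] has_derivative_continuous[OF der(3)]; assumption)+
  \<comment> \<open>The height of the chart in direction \<open>v\<close> is maximal at the
    parameter \<open>w v\<close>, so both of its partial derivatives vanish there.\<close>
  have crit: "p v \<bullet> v = 0" "q v \<bullet> v = 0" if v: "v \<in> V0" for v
  proof -
    have "((\<lambda>y. \<phi> y \<bullet> v) has_derivative (\<lambda>a :: real^2. (a $ 1 *\<^sub>R p v + a $ 2 *\<^sub>R q v) \<bullet> v)) (at (w v))"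
      unfolding p_def q_def by (rule has_derivative_inner_left[OF der(1)[OF wU[OF v]]])
    moreover have "\<forall>y\<in>U. \<phi> y \<bullet> v \<le> \<phi> (w v) \<bullet> v"
    proof
      fix y assume "y \<in> U"
      then have "\<phi> y \<in> K"
        using T(2) convex_bodyD(3)[OF cb] by (auto simp: frontier_def closure_closed)
      then show "\<phi> y \<bullet> v \<le> \<phi> (w v) \<bullet> v" using support_point(2)[OF cb] by (simp add: \<phi>w[OF v])
    qed
    ultimately have "(\<lambda>a :: real^2. (a $ 1 *\<^sub>R p v + a $ 2 *\<^sub>R q v) \<bullet> v) = (\<lambda>a. 0)"
      using differential_zero_maxmin[OF wU[OF v] U] by blast
    from fun_cong[OF this, of "vector [1, 0]"] fun_cong[OF this, of "vector [0, 1]"]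
    show "p v \<bullet> v = 0" "q v \<bullet> v = 0" by simp_all
  qed
  define \<Delta> where "\<Delta> = (\<lambda>v. L v * N v - (M v)\<^sup>2)"
  \<comment> \<open>The chart is known to have positive curvature only at \<open>w0\<close>;
    positivity of \<open>\<Delta>\<close> is therefore shown at \<open>v0\<close> and spread to a
    neighbourhood by continuity.\<close>
  define V where "V = V0 \<inter> \<Delta> -` {0<..}"
  have V: "open V" unfolding V_def \<Delta>_def
    by (rule continuous_open_preimage[OF _ V0]) (auto intro!: continuous_intros cont)
  have VV0: "V \<subseteq> V0" by (auto simp: V_def)
  have "v0 \<in> V"
  proof -
    have "?x v0 \<in> \<phi> ` U" using w0 by (metis imageI)
    then have v0V0: "v0 \<in> V0" using v0 T(2) by (auto simp: V0_def)
    have ww0: "w v0 = w0" using w0 \<psi>(2) by (simp add: w_def flip: w0(2))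
    define n where "n = chart_normal \<phi> w0"
    define c where "c = cross3 (p v0) (q v0)"
    have c: "c \<noteq> 0" unfolding c_def p_def q_def by (rule cross[OF wU[OF v0V0]])
    have "(c \<bullet> c) *\<^sub>R v0 = (c \<bullet> v0) *\<^sub>R c"
      unfolding c_def by (rule orthogonal_cross3_parallel[OF crit[OF v0V0]])
    then have "(1 / (c \<bullet> c)) *\<^sub>R ((c \<bullet> c) *\<^sub>R v0) = (1 / (c \<bullet> c)) *\<^sub>R ((c \<bullet> v0) *\<^sub>R c)" by simp
    then have "v0 = ((c \<bullet> v0) / (c \<bullet> c)) *\<^sub>R c" using c by simp
    moreover have "n = (1 / norm c) *\<^sub>R c"
      by (simp add: n_def c_def chart_normal_def p_def q_def ww0 sgn_div_norm divide_inverse)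
    ultimately have v0n: "v0 = ((c \<bullet> v0) / norm c) *\<^sub>R n"
      using c by (simp add: dot_square_norm power2_eq_square)
    \<comment> \<open>Both \<open>v0\<close> and the chart normal are orthogonal to the tangent
      plane, so they differ by a factor \<open>k\<close>. Its sign depends on the orientation of the
      chart, but \<open>\<Delta> v0\<close> scales with \<open>k\<^sup>2\<close>.\<close>
    define k where "k = (c \<bullet> v0) / norm c"
    have v0k: "v0 = k *\<^sub>R n" using v0n by (simp add: k_def)
    have "k \<noteq> 0" using v0 v0k by auto
    have "\<Delta> v0 = k\<^sup>2 * ((r w0 \<bullet> n) * (t w0 \<bullet> n) - (s w0 \<bullet> n)\<^sup>2)"
      unfolding \<Delta>_def L_def M_def N_def ww0 by (subst (1 2 3) v0k) (simp add: power2_eq_square algebra_simps)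
    moreover have "(s w0 \<bullet> n)\<^sup>2 < (r w0 \<bullet> n) * (t w0 \<bullet> n)"
      using chart_curvature_pos[OF pos] by (simp add: r_def s_def t_def n_def)
    ultimately have "\<Delta> v0 > 0" using \<open>k \<noteq> 0\<close> by simp
    then show ?thesis using v0V0 by (simp add: V_def)
  qed
  have derx: "(?x has_derivative
          (\<lambda>b. - (1 / \<Delta> v) *\<^sub>R
              ((N v * (p v \<bullet> b) - M v * (q v \<bullet> b)) *\<^sub>R p v +
               (L v * (q v \<bullet> b) - M v * (p v \<bullet> b)) *\<^sub>R q v))) (at v)" if v: "v \<in> V" for v
  proof -
    have vV0: "v \<in> V0" and \<Delta>: "\<Delta> v > 0" using v by (auto simp: V_def)
    note wU = wU[OF vV0]
    \<comment> \<open>The critical point equations of \<open>crit\<close> as one map vanishing along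
      \<open>w\<close>. Its derivative in the parameter is \<open>A\<close>, with matrix entries
      \<open>L\<close>, \<open>M\<close>, \<open>M\<close>, \<open>N\<close>; \<open>A'\<close> is
      the adjugate divided by \<open>\<Delta> v\<close>.\<close>
    define G where "G = (\<lambda>z :: (real^2) \<times> (real^3). (chart_D1 \<phi> (fst z) \<bullet> snd z, chart_D2 \<phi> (fst z) \<bullet> snd z))"
    define A where "A = (\<lambda>a :: real^2. (a $ 1 * L v + a $ 2 * M v, a $ 1 * M v + a $ 2 * N v))"
    define B where "B = (\<lambda>b. (p v \<bullet> b, q v \<bullet> b))"
    define A' where "A' = (\<lambda>c :: real \<times> real. (fst c / \<Delta> v) *\<^sub>R (vector [N v, - M v] :: real^2)
        + (snd c / \<Delta> v) *\<^sub>R vector [- M v, L v])"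
    have D1: "((\<lambda>z :: (real^2) \<times> (real^3). chart_D1 \<phi> (fst z)) has_derivative (\<lambda>z. fst z $ 1 *\<^sub>R r (w v) + fst z $ 2 *\<^sub>R s (w v))) (at (w v, v))"
      unfolding r_def s_def
      by (rule has_derivative_compose[where f=fst and g="chart_D1 \<phi>"])
        (auto intro!: derivative_eq_intros der(2)[OF wU])
    have D2: "((\<lambda>z :: (real^2) \<times> (real^3). chart_D2 \<phi> (fst z)) has_derivative (\<lambda>z. fst z $ 1 *\<^sub>R s (w v) + fst z $ 2 *\<^sub>R t (w v))) (at (w v, v))"
      unfolding s_def t_def
      by (rule has_derivative_compose[where f=fst and g="chart_D2 \<phi>"])
        (auto intro!: derivative_eq_intros der(3)[OF wU])
    have "(w has_derivative (\<lambda>b. - A' (B b))) (at v)"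
    proof (rule implicit_function_has_derivative[where G = G and A = A])
      show "(G has_derivative (\<lambda>z. A (fst z) + B (snd z))) (at (w v, v))"
        unfolding G_def
        by (rule has_derivative_eq_rhs, (rule derivative_intros D1 D2)+)
          (auto simp: fun_eq_iff A_def B_def L_def M_def N_def p_def q_def inner_simps)
      show "bounded_linear A'"
        unfolding A'_def
        by (intro bounded_linear_intros bounded_linear_compose[OF bounded_linear_divide bounded_linear_fst]
          bounded_linear_compose[OF bounded_linear_divide bounded_linear_snd])
      show "bounded_linear B"
        unfolding B_def by (intro bounded_linear_intros bounded_linear_Pair)
      show "A' (A a) = a" for a
        using \<Delta> unfolding A'_def A_def
        by (simp add: vec_eq_iff forall_2 divide_simps) (simp add: \<Delta>_def power2_eq_square algebra_simps)
      show "isCont w v" using contw V0 vV0 by (simp add: continuous_on_eq_continuous_at)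
      have "G (w z, z) = 0" if "z \<in> V0" for z
        using crit[OF that] by (simp add: G_def p_def q_def zero_prod_def)
      then show "\<forall>\<^sub>F z in nhds v. G (w z, z) = G (w v, v)"
        using vV0 V0 unfolding eventually_nhds by (intro exI[of _ V0]) auto
    qed
    from has_derivative_compose[OF this der(1)[OF wU]]
    have "((\<lambda>y. \<phi> (w y)) has_derivative
       (\<lambda>b. (- A' (B b)) $ 1 *\<^sub>R p v + (- A' (B b)) $ 2 *\<^sub>R q v)) (at v)"
      by (simp add: p_def q_def)
    then have "(?x has_derivative
       (\<lambda>b. (- A' (B b)) $ 1 *\<^sub>R p v + (- A' (B b)) $ 2 *\<^sub>R q v)) (at v)"
      by (rule has_derivative_transform_within_open[OF _ V0 vV0]) (rule \<phi>w)
    then show ?thesis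
      by (rule has_derivative_eq_rhs)
        (auto simp: fun_eq_iff A'_def B_def algebra_simps diff_divide_distrib add_divide_distrib)
  qed
  show ?thesis
  proof (rule that[of V p q L M N])
    show "open V" by (rule V)
    show "v0 \<in> V" by fact
    show "0 \<notin> V" by (auto simp: V_def V0_def)
    show "continuous_on V p" "continuous_on V q" "continuous_on V L" "continuous_on V M" "continuous_on V N"
      by (rule continuous_on_subset[OF _ VV0], rule cont)+
    show "\<forall>v\<in>V. (M v)\<^sup>2 < L v * N v" by (simp add: V_def \<Delta>_def)
    show "\<forall>v\<in>V. p v \<bullet> v = 0 \<and> q v \<bullet> v = 0 \<and> cross3 (p v) (q v) \<noteq> 0"
      using crit cross[OF wU] VV0 by (auto simp: p_def q_def)
  qed (use derx in \<open>simp add: \<Delta>_def\<close>)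
qed

text \<open>Multiplication by \<open>L\<close> completes the square whatever the sign of
  \<open>L\<close>. The coefficients are those of the adjugate matrix, as they occur in the
  derivative of the support point.\<close>

lemma definite_quadratic_form:
  fixes L M N P Q :: real
  assumes "M\<^sup>2 < L * N" "N * P\<^sup>2 - 2 * M * P * Q + L * Q\<^sup>2 = 0"
  shows "P = 0 \<and> Q = 0"
proof -
  have "(L * Q - M * P)\<^sup>2 + (L * N - M\<^sup>2) * P\<^sup>2 = L * (N * P\<^sup>2 - 2 * M * P * Q + L * Q\<^sup>2)"
    by (simp add: power2_eq_square algebra_simps)
  then have "(L * Q - M * P)\<^sup>2 + (L * N - M\<^sup>2) * P\<^sup>2 = 0" using assms(2) by simp
  moreover have "0 \<le> (L * N - M\<^sup>2) * P\<^sup>2" using assms(1) by simp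
  ultimately have "(L * N - M\<^sup>2) * P\<^sup>2 = 0" using zero_le_power2[of "L * Q - M * P"] by linarith
  then have "P = 0" using assms(1) by auto
  moreover have "L \<noteq> 0" using assms(1) by (auto simp: not_less)
  ultimately show ?thesis using assms(2) by simp
qed

text \<open>All claims are local, so the chart formula proves them near each \<open>v0\<close> for
  the chart-independent derivative \<open>D\<close>. The sign of the quadratic form is hidden by the
  orientation of the chart; it comes from monotonicity instead, and the chart formula only excludes
  zeros transversal to \<open>v0\<close>.\<close>

lemma support_point_C1:
  fixes K :: "(real^3) set"
  assumes K: "strictly_convex_body K" and S: "C2_surface (frontier K)"
    and curv: "\<And>x. x \<in> frontier K \<Longrightarrow> gaussian_curvature (frontier K) x > 0"
  obtains D where "\<forall>v. v \<noteq> 0 \<longrightarrow> (support_point K has_derivative D v) (at v)"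
    and "\<forall>b. continuous_on (- {0}) (\<lambda>v. D v b)"
    and "\<forall>v b c. v \<noteq> 0 \<longrightarrow> D v b \<bullet> c = D v c \<bullet> b"
    and "\<forall>v b. v \<noteq> 0 \<longrightarrow> (\<forall>c. b \<noteq> c *\<^sub>R v) \<longrightarrow> 0 < D v b \<bullet> b"
proof -
  have cb: "convex_body K" using K by (simp add: strictly_convex_body_def)
  define D where "D = (\<lambda>v. frechet_derivative (support_point K) (at v))"
  have "(support_point K has_derivative D v0) (at v0) \<and> isCont (\<lambda>v. D v b) v0 \<and>
     D v0 b \<bullet> c = D v0 c \<bullet> b \<and> ((\<forall>c. b \<noteq> c *\<^sub>R v0) \<longrightarrow> 0 < D v0 b \<bullet> b)" if v0: "v0 \<noteq> 0" for v0 b c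
  proof -
    obtain V p q L M N where V: "open V" "v0 \<in> V" "0 \<notin> V"
      and cont: "continuous_on V p" "continuous_on V q" "continuous_on V L" "continuous_on V M" "continuous_on V N"
      and \<Delta>: "\<forall>v\<in>V. (M v)\<^sup>2 < L v * N v"
      and orth: "\<forall>v\<in>V. p v \<bullet> v = 0 \<and> q v \<bullet> v = 0 \<and> cross3 (p v) (q v) \<noteq> 0"
      and der: "\<forall>v\<in>V. (support_point K has_derivative
          (\<lambda>b. - (1 / (L v * N v - (M v)\<^sup>2)) *\<^sub>R
              ((N v * (p v \<bullet> b) - M v * (q v \<bullet> b)) *\<^sub>R p v +
               (L v * (q v \<bullet> b) - M v * (p v \<bullet> b)) *\<^sub>R q v))) (at v)"
      using support_point_local[OF K S curv v0] .
    note \<Delta> = bspec[OF \<Delta>] and der = bspec[OF der]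
    have orth: "p v0 \<bullet> v0 = 0" "q v0 \<bullet> v0 = 0" "cross3 (p v0) (q v0) \<noteq> 0" using orth V(2) by auto
    have D: "D v = (\<lambda>b. - (1 / (L v * N v - (M v)\<^sup>2)) *\<^sub>R
              ((N v * (p v \<bullet> b) - M v * (q v \<bullet> b)) *\<^sub>R p v +
               (L v * (q v \<bullet> b) - M v * (p v \<bullet> b)) *\<^sub>R q v))" if "v \<in> V" for v
      unfolding D_def using frechet_derivative_at[OF der[OF that]] by simp
    have d0: "(support_point K has_derivative D v0) (at v0)" using der[OF V(2)] D[OF V(2)] by simp
    have "continuous_on V (\<lambda>v. - (1 / (L v * N v - (M v)\<^sup>2)) *\<^sub>R
              ((N v * (p v \<bullet> b) - M v * (q v \<bullet> b)) *\<^sub>R p v +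
               (L v * (q v \<bullet> b) - M v * (p v \<bullet> b)) *\<^sub>R q v))"
      using \<Delta> by (intro continuous_intros cont ballI) force
    then have "continuous_on V (\<lambda>v. D v b)" using D by (simp cong: continuous_on_cong)
    then have c0: "isCont (\<lambda>v. D v b) v0" using V by (simp add: continuous_on_eq_continuous_at)
    have sym: "D v0 b \<bullet> c = D v0 c \<bullet> b"
      by (simp add: D[OF V(2)] inner_simps algebra_simps inner_commute)
    have pos: "0 < D v0 b \<bullet> b" if b: "\<forall>c. b \<noteq> c *\<^sub>R v0"
    proof (rule ccontr)
      assume "\<not> 0 < D v0 b \<bullet> b"
      then have "D v0 b \<bullet> b = 0" using derivative_support_point_nonneg[OF cb d0, of b] by simp
      moreover have "D v0 b \<bullet> b = - (1 / (L v0 * N v0 - (M v0)\<^sup>2)) *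
          (N v0 * (p v0 \<bullet> b)\<^sup>2 - 2 * M v0 * (p v0 \<bullet> b) * (q v0 \<bullet> b) + L v0 * (q v0 \<bullet> b)\<^sup>2)"
        by (simp add: D[OF V(2)] inner_simps power2_eq_square algebra_simps)
      ultimately have zero: "N v0 * (p v0 \<bullet> b)\<^sup>2 - 2 * M v0 * (p v0 \<bullet> b) * (q v0 \<bullet> b) + L v0 * (q v0 \<bullet> b)\<^sup>2 = 0"
        using \<Delta>[OF V(2)] by auto
      have pq: "p v0 \<bullet> b = 0" "q v0 \<bullet> b = 0"
        using definite_quadratic_form[OF \<Delta>[OF V(2)] zero] by simp_all
      \<comment> \<open>Both \<open>v0\<close> and \<open>b\<close> are orthogonal to the tangent
        vectors, hence multiples of \<open>n\<close>; since \<open>v0\<close> is nonzero,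
        \<open>b\<close> is a multiple of \<open>v0\<close>, contrary to assumption.\<close>
      define n where "n = cross3 (p v0) (q v0)"
      have n: "n \<bullet> n \<noteq> 0" using orth(3) by (simp add: n_def)
      have nv: "(n \<bullet> n) *\<^sub>R v0 = (n \<bullet> v0) *\<^sub>R n"
        unfolding n_def by (rule orthogonal_cross3_parallel[OF orth(1,2)])
      have nb: "(n \<bullet> n) *\<^sub>R b = (n \<bullet> b) *\<^sub>R n"
        unfolding n_def by (rule orthogonal_cross3_parallel[OF pq])
      have "n \<bullet> v0 \<noteq> 0" using nv n v0 by auto
      then have "(n \<bullet> n) *\<^sub>R b = ((n \<bullet> b) / (n \<bullet> v0)) *\<^sub>R ((n \<bullet> v0) *\<^sub>R n)" by (simp add: nb)
      also have "\<dots> = (n \<bullet> n) *\<^sub>R (((n \<bullet> b) / (n \<bullet> v0)) *\<^sub>R v0)"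
        by (simp only: nv[symmetric] scaleR_left_commute)
      finally have "b = ((n \<bullet> b) / (n \<bullet> v0)) *\<^sub>R v0" using n by (simp only: scaleR_cancel_left) blast
      then show False using b by blast
    qed
    show ?thesis using d0 c0 sym pos by blast
  qed
  note * = this
  show ?thesis
  proof (rule that[of D])
    show "\<forall>b. continuous_on (- {0}) (\<lambda>v. D v b)"
      using * by (intro allI continuous_at_imp_continuous_on) auto
  qed (use * in blast)+
qed

section \<open>The partial Legendre transform\<close>

text \<open>The chain rule applied to the gradient \<open>x\<close>. Differentiating
  \<open>u'\<close> contributes \<open>- x s t \<bullet> u s\<close> to \<open>F11\<close>, which
  cancels against \<open>F s t - t * F2 s t\<close> and leaves the quadratic form of the derivative
  of the support point at \<open>u' s\<close>. Positivity follows because neither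
  \<open>u' s\<close> nor \<open>\<nu>\<close> is a multiple of
  \<open>u s + t *\<^sub>R \<nu>\<close>.\<close>

lemma support_function_cylindrical:
  fixes K :: "(real^3) set" and \<nu> e1 e2 :: "real^3"
  assumes K: "strictly_convex_body K" and S: "C2_surface (frontier K)"
    and curv: "\<And>x. x \<in> frontier K \<Longrightarrow> gaussian_curvature (frontier K) x > 0"
    and orth: "norm \<nu> = 1" "norm e1 = 1" "norm e2 = 1" "e1 \<bullet> e2 = 0" "e1 \<bullet> \<nu> = 0" "e2 \<bullet> \<nu> = 0"
    and u_def: "u = (\<lambda>s. cos s *\<^sub>R e1 + sin s *\<^sub>R e2)"
    and u'_def: "u' = (\<lambda>s. - sin s *\<^sub>R e1 + cos s *\<^sub>R e2)"
    and x_def: "x = (\<lambda>s t. support_point K (u s + t *\<^sub>R \<nu>))"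
    and F_def: "F = (\<lambda>s t. support_function K (u s + t *\<^sub>R \<nu>))"
    and F1_def: "F1 = (\<lambda>s t. x s t \<bullet> u' s)" and F2_def: "F2 = (\<lambda>s t. x s t \<bullet> \<nu>)"
  obtains F11 F12 F22 where
    "\<forall>s t. (case_prod F has_derivative (\<lambda>h. F1 s t * fst h + F2 s t * snd h)) (at (s, t))"
    "\<forall>s t. (case_prod F1 has_derivative (\<lambda>h. F11 s t * fst h + F12 s t * snd h)) (at (s, t))"
    "\<forall>s t. (case_prod F2 has_derivative (\<lambda>h. F12 s t * fst h + F22 s t * snd h)) (at (s, t))"
    "continuous_on UNIV (case_prod F11)" "continuous_on UNIV (case_prod F12)" "continuous_on UNIV (case_prod F22)"
    "\<forall>s t. F22 s t > 0" "\<forall>s t. F11 s t + F s t - t * F2 s t > 0"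
proof -
  have cb: "convex_body K" using K by (simp add: strictly_convex_body_def)
  obtain D where D: "\<forall>v. v \<noteq> 0 \<longrightarrow> (support_point K has_derivative D v) (at v)"
    and contD: "\<forall>b. continuous_on (- {0}) (\<lambda>v. D v b)"
    and sym: "\<forall>v b c. v \<noteq> 0 \<longrightarrow> D v b \<bullet> c = D v c \<bullet> b"
    and pos: "\<forall>v b. v \<noteq> 0 \<longrightarrow> (\<forall>c. b \<noteq> c *\<^sub>R v) \<longrightarrow> 0 < D v b \<bullet> b"
    using support_point_C1[OF K S curv] .
  note D = D[rule_format] and contD = contD[rule_format] and sym = sym[rule_format] and pos = pos[rule_format]
  have e: "e1 \<bullet> e1 = 1" "e2 \<bullet> e2 = 1" "\<nu> \<bullet> \<nu> = 1" using orth by (simp_all add: norm_eq_1)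
  have uu: "u s \<bullet> u s = 1" "u' s \<bullet> u' s = 1" "u s \<bullet> u' s = 0" "u s \<bullet> \<nu> = 0" "u' s \<bullet> \<nu> = 0" for s
    using orth e sin_cos_squared_add[of s] unfolding u_def u'_def
    by (simp_all add: inner_simps inner_commute power2_eq_square algebra_simps)
  define v where "v = (\<lambda>s t. u s + t *\<^sub>R \<nu>)"
  \<comment> \<open>This shows that \<open>v s t\<close> is nonzero and, later, that a multiple of
    it orthogonal to \<open>u s\<close> must be zero.\<close>
  have vu: "v s t \<bullet> u s = 1" for s t using uu[of s] by (simp add: v_def inner_simps inner_commute)
  have v0: "v s t \<noteq> 0" for s t using vu[of s t] by auto
  have du: "(u has_derivative (\<lambda>h. h *\<^sub>R u' s)) (at s)"  "(u' has_derivative (\<lambda>h. - (h *\<^sub>R u s))) (at s)" for s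
    unfolding u_def u'_def by (auto intro!: derivative_eq_intros simp: fun_eq_iff algebra_simps)
  have dv: "(case_prod v has_derivative (\<lambda>h. fst h *\<^sub>R u' s + snd h *\<^sub>R \<nu>)) (at (s, t))" for s t
    unfolding v_def case_prod_unfold
    by (auto intro!: derivative_eq_intros has_derivative_compose[where g = u and f = fst] du)
  have linD: "linear (D (v s t))" for s t using has_derivative_linear[OF D[OF v0]] .
  have dx: "(case_prod x has_derivative (\<lambda>h. fst h *\<^sub>R D (v s t) (u' s) + snd h *\<^sub>R D (v s t) \<nu>)) (at (s, t))" for s t
  proof -
    have "((\<lambda>z. support_point K (case_prod v z)) has_derivative (\<lambda>h. D (v s t) (fst h *\<^sub>R u' s + snd h *\<^sub>R \<nu>))) (at (s, t))"
      by (rule has_derivative_compose[where g="support_point K" and f="case_prod v", OF dv]) (use D[OF v0] in simp)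
    moreover have "(\<lambda>z. support_point K (case_prod v z)) = case_prod x" by (auto simp: x_def v_def)
    ultimately show ?thesis using linD by (simp add: linear_add linear_cmul)
  qed
  have du'': "((\<lambda>z. u' (fst z)) has_derivative (\<lambda>h. - (fst h *\<^sub>R u s))) (at (s, t :: real))" for s t
    by (rule has_derivative_compose[where g = u' and f = fst]) (auto intro!: derivative_eq_intros du)
  define F11 where "F11 = (\<lambda>s t. D (v s t) (u' s) \<bullet> u' s - x s t \<bullet> u s)"
  define F12 where "F12 = (\<lambda>s t. D (v s t) \<nu> \<bullet> u' s)"
  define F22 where "F22 = (\<lambda>s t. D (v s t) \<nu> \<bullet> \<nu>)"
  have cv: "continuous_on UNIV (case_prod v)"
    using has_derivative_continuous[OF dv] by (intro continuous_at_imp_continuous_on) auto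
  have cx: "continuous_on UNIV (case_prod x)"
    using has_derivative_continuous[OF dx] by (intro continuous_at_imp_continuous_on) auto
  have cD: "continuous_on UNIV (\<lambda>z. D (case_prod v z) b)" for b
    by (rule continuous_on_compose2[OF contD cv]) (use v0 in auto)
  have cu: "continuous_on UNIV (\<lambda>z :: real \<times> real. u (fst z))" "continuous_on UNIV (\<lambda>z :: real \<times> real. u' (fst z))"
    unfolding u_def u'_def by (auto intro!: continuous_intros)
  \<comment> \<open>Continuity of the derivative is available only for a fixed argument, so the
    moving vector \<open>u' s\<close> is expanded in \<open>e1\<close> and
    \<open>e2\<close>.\<close>
  have Du': "D (v s t) (u' s) = - sin s *\<^sub>R D (v s t) e1 + cos s *\<^sub>R D (v s t) e2" for s t
    unfolding u'_def by (simp only: linear_add[OF linD] linear_cmul[OF linD])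
  show ?thesis
  proof (rule that[of F11 F12 F22]; (intro allI)?)
    fix s t
    have "((\<lambda>z. support_function K (case_prod v z)) has_derivative (\<lambda>h. support_point K (v s t) \<bullet> (fst h *\<^sub>R u' s + snd h *\<^sub>R \<nu>))) (at (s, t))"
      by (rule has_derivative_compose[where g="support_function K" and f="case_prod v", OF dv])
        (use has_derivative_support_function[OF K v0] in simp)
    moreover have "(\<lambda>z. support_function K (case_prod v z)) = case_prod F" by (auto simp: F_def v_def)
    ultimately show "(case_prod F has_derivative (\<lambda>h. F1 s t * fst h + F2 s t * snd h)) (at (s, t))"
      by (simp add: F1_def F2_def x_def v_def inner_simps mult.commute)
    have "((\<lambda>z. case_prod x z \<bullet> u' (fst z)) has_derivative (\<lambda>h. F11 s t * fst h + F12 s t * snd h)) (at (s, t))"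
      by (rule has_derivative_eq_rhs[OF has_derivative_inner[OF dx du'']])
        (auto simp: fun_eq_iff F11_def F12_def inner_simps algebra_simps)
    then show "(case_prod F1 has_derivative (\<lambda>h. F11 s t * fst h + F12 s t * snd h)) (at (s, t))"
      by (simp add: F1_def case_prod_unfold)
    have "((\<lambda>z. case_prod x z \<bullet> \<nu>) has_derivative (\<lambda>h. F12 s t * fst h + F22 s t * snd h)) (at (s, t))"
      by (rule has_derivative_eq_rhs[OF has_derivative_inner_left[OF dx]])
        (auto simp: fun_eq_iff F12_def F22_def inner_simps sym[OF v0, of _ _ "u' _" \<nu>])
    then show "(case_prod F2 has_derivative (\<lambda>h. F12 s t * fst h + F22 s t * snd h)) (at (s, t))"
      by (simp add: F2_def case_prod_unfold)
    show "F22 s t > 0" unfolding F22_def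
    proof (rule pos[OF v0])
      show "\<nu> \<noteq> c *\<^sub>R v s t" for c
      proof
        assume *: "\<nu> = c *\<^sub>R v s t"
        have "c * (v s t \<bullet> u s) = 0" using uu(4)[of s] by (metis * inner_scaleR_left inner_commute)
        then have "c = 0" by (simp add: vu)
        then show False using * e(3) by simp
      qed
    qed
    have "0 < D (v s t) (u' s) \<bullet> u' s"
    proof (rule pos[OF v0])
      show "u' s \<noteq> c *\<^sub>R v s t" for c
      proof
        assume *: "u' s = c *\<^sub>R v s t"
        have "c * (v s t \<bullet> u s) = 0" using uu(3)[of s] by (metis * inner_scaleR_left inner_commute)
        then have "c = 0" by (simp add: vu)
        then show False using * uu(2)[of s] by simp
      qed
    qed
    then show "F11 s t + F s t - t * F2 s t > 0"
      by (simp add: F11_def F2_def F_def x_def support_function_eq[OF cb] inner_simps)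
  next
    have "continuous_on UNIV (\<lambda>z. (- sin (fst z) *\<^sub>R D (case_prod v z) e1 + cos (fst z) *\<^sub>R D (case_prod v z) e2) \<bullet> u' (fst z) - case_prod x z \<bullet> u (fst z))"
      by (intro continuous_intros cD cx cu)
    then show "continuous_on UNIV (case_prod F11)"
      by (simp add: F11_def Du' case_prod_unfold)
    have "continuous_on UNIV (\<lambda>z. D (case_prod v z) \<nu> \<bullet> u' (fst z))"
      by (intro continuous_intros cD cx cu)
    then show "continuous_on UNIV (case_prod F12)"
      by (simp add: F12_def case_prod_unfold)
    have "continuous_on UNIV (\<lambda>z. D (case_prod v z) \<nu> \<bullet> \<nu>)"
      by (intro continuous_intros cD cx cu)
    then show "continuous_on UNIV (case_prod F22)"
      by (simp add: F22_def case_prod_unfold)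
  qed
qed

section \<open>Minimisers of coercive functions and their dependence on parameters\<close>

lemma continuous_attains_inf_coercive:
  fixes f :: "real \<Rightarrow> real"
  assumes f: "continuous_on UNIV f" and "c > 0" "d > 0"
    and ge: "\<And>t. a + c * t \<le> f t" "\<And>t. b - d * t \<le> f t"
  obtains t where "\<And>s. f t \<le> f s"
proof -
  \<comment> \<open>Outside the interval from \<open>-R\<close> to \<open>R\<close> one of the two
    linear lower bounds is already at least \<open>f 0\<close>, so a minimum over the interval is
    global.\<close>
  define R where "R = max 0 (max ((f 0 - a) / c) ((f 0 - b) / d))"
  have R: "0 \<le> R" "f 0 - a \<le> c * R" "f 0 - b \<le> d * R"
  proof -
    have "(f 0 - a) / c \<le> R" "(f 0 - b) / d \<le> R" by (auto simp: R_def)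
    then show "f 0 - a \<le> c * R" "f 0 - b \<le> d * R" using assms(2,3) by (simp_all add: field_simps)
  qed (simp add: R_def)
  have "continuous_on {-R..R} f" by (rule continuous_on_subset[OF f]) simp
  then obtain t where t: "\<forall>s\<in>{-R..R}. f t \<le> f s"
    using continuous_attains_inf[of "{-R..R}" f] R(1) by auto
  have "f t \<le> f s" for s
  proof (cases "s \<in> {-R..R}")
    case False
    have "f t \<le> f 0" using t R(1) by simp
    also have "f 0 \<le> f s"
    proof (cases "s > R")
      case True
      then have "c * R \<le> c * s" using assms(2) by simp
      then show ?thesis using ge(1)[of s] R(2) by linarith
    next
      case False
      then have "d * R \<le> d * (- s)" using \<open>s \<notin> {-R..R}\<close> assms(3) by (intro mult_left_mono) auto
      then show ?thesis using ge(2)[of s] R(3) by simp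
    qed
    finally show ?thesis .
  qed (use t in blast)
  then show ?thesis by (rule that)
qed

text \<open>For a fixed number \<open>a\<close>, strict monotonicity decides whether
  \<open>a\<close> lies below or above \<open>l s p\<close> by the sign of \<open>g s a - p\<close>,
  and a strict sign persists under small changes of \<open>s\<close> and \<open>p\<close>.\<close>

lemma isCont_strictly_monotone_implicit:
  fixes g l :: "real \<Rightarrow> real \<Rightarrow> real"
  assumes g: "continuous_on UNIV (case_prod g)" and mono: "\<And>s. strict_mono (g s)"
    and l: "\<And>s p. p \<in> {m<..<M} \<Longrightarrow> g s (l s p) = p" and p: "p \<in> {m<..<M}"
  shows "isCont (case_prod l) (s, p)"
proof -
  have cont: "isCont (\<lambda>z. g (fst z) a - snd z) (s, p)" for a
  proof -
    have "continuous_on UNIV (\<lambda>z :: real \<times> real. case_prod g (fst z, a))"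
      by (rule continuous_on_compose2[OF g]) (auto intro!: continuous_intros)
    then have "continuous_on UNIV (\<lambda>z :: real \<times> real. g (fst z) a - snd z)"
      by (auto intro!: continuous_intros)
    then show ?thesis by (simp add: continuous_on_eq_continuous_at)
  qed
  have "open (UNIV \<times> {m<..<M} :: (real \<times> real) set)" by (intro open_Times) auto
  then have dom: "\<forall>\<^sub>F z in at (s, p). z \<in> UNIV \<times> {m<..<M}" using p by (intro eventually_at_in_open') auto
  have "((\<lambda>z. case_prod l z) \<longlongrightarrow> l s p) (at (s, p))"
  proof (rule order_tendstoI)
    fix a assume "a < l s p"
    then have "g s a - p < 0" using strict_monoD[OF mono, of a "l s p" s] l[OF p] by simp
    then have "\<forall>\<^sub>F z in at (s, p). g (fst z) a - snd z < 0"
      using order_tendstoD(2)[OF cont[of a, unfolded isCont_def], of 0] by simp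
    with dom show "\<forall>\<^sub>F z in at (s, p). a < case_prod l z"
    proof eventually_elim
      case (elim z)
      then have "g (fst z) a < g (fst z) (l (fst z) (snd z))" by (auto simp: l)
      then show ?case using strict_mono_less[OF mono] by (simp add: case_prod_unfold)
    qed
  next
    fix a assume "l s p < a"
    then have "0 < g s a - p" using strict_monoD[OF mono, of "l s p" a s] l[OF p] by simp
    then have "\<forall>\<^sub>F z in at (s, p). 0 < g (fst z) a - snd z"
      using order_tendstoD(1)[OF cont[of a, unfolded isCont_def], of 0] by simp
    with dom show "\<forall>\<^sub>F z in at (s, p). case_prod l z < a"
    proof eventually_elim
      case (elim z)
      then have "g (fst z) (l (fst z) (snd z)) < g (fst z) a" by (auto simp: l)
      then show ?case using strict_mono_less[OF mono] by (simp add: case_prod_unfold)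
    qed
  qed
  then show ?thesis by (simp add: isCont_def)
qed

lemma partial_legendre_transform:
  fixes F F1 F2 F11 F12 F22 H l :: "real \<Rightarrow> real \<Rightarrow> real"
  assumes F: "\<And>s t. (case_prod F has_derivative (\<lambda>h. F1 s t * fst h + F2 s t * snd h)) (at (s, t))"
    and F1: "\<And>s t. (case_prod F1 has_derivative (\<lambda>h. F11 s t * fst h + F12 s t * snd h)) (at (s, t))"
    and F2: "\<And>s t. (case_prod F2 has_derivative (\<lambda>h. F12 s t * fst h + F22 s t * snd h)) (at (s, t))"
    and cont: "continuous_on UNIV (case_prod F11)" "continuous_on UNIV (case_prod F12)" "continuous_on UNIV (case_prod F22)"
    and pos: "\<And>s t. F22 s t > 0"
    and l: "\<And>s p. p \<in> {m<..<M} \<Longrightarrow> F2 s (l s p) = p"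
    and H: "\<And>s p. p \<in> {m<..<M} \<Longrightarrow> H s p = F s (l s p) - l s p * p"
  shows "C2_on (UNIV \<times> {m<..<M}) (case_prod H)"
    and "p \<in> {m<..<M} \<Longrightarrow> pd1 (pd1 H) s p = F11 s (l s p) - (F12 s (l s p))\<^sup>2 / F22 s (l s p)"
    and "p \<in> {m<..<M} \<Longrightarrow> pd2 (pd1 H) s p = F12 s (l s p) / F22 s (l s p)"
    and "p \<in> {m<..<M} \<Longrightarrow> pd2 (pd2 H) s p = - (1 / F22 s (l s p))"
proof -
  have mono: "strict_mono (F2 s)" for s
  proof (rule strict_monoI)
    fix x y :: real assume "x < y"
    then show "F2 s x < F2 s y"
      by (rule DERIV_pos_imp_increasing) (use partial_derivatives_curried(2)[OF F2] pos in blast)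
  qed
  have F2cont: "continuous_on UNIV (case_prod F2)"
    using has_derivative_continuous[OF F2] by (intro continuous_at_imp_continuous_on) auto
  have lcont: "isCont (case_prod l) (s, p)" if "p \<in> {m<..<M}" for s p
    by (rule isCont_strictly_monotone_implicit[OF F2cont mono l that])
  let ?U = "UNIV \<times> {m<..<M} :: (real \<times> real) set"
  have U: "open ?U" by (intro open_Times) auto
  define l1 where "l1 = (\<lambda>s p. - (F12 s (l s p) / F22 s (l s p)))"
  define l2 where "l2 = (\<lambda>s p. 1 / F22 s (l s p))"
  have dl: "(case_prod l has_derivative (\<lambda>h. l1 s p * fst h + l2 s p * snd h)) (at (s, p))"
    if p: "p \<in> {m<..<M}" for s p
  proof -
    \<comment> \<open>The equation \<open>F2 s (l s p) = p\<close> in the form required for implicit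
      differentiation: the unknown is the first component of \<open>z\<close>, and the parameters
      \<open>s\<close> and \<open>p\<close> form the second.\<close>
    let ?A = "\<lambda>a. F22 s (l s p) * a" and ?A' = "\<lambda>c. c / F22 s (l s p)"
      and ?G = "\<lambda>z. F2 (fst (snd z)) (fst z) - snd (snd z)"
      and ?B = "\<lambda>b. F12 s (l s p) * fst b - snd b"
    have "((\<lambda>z. case_prod F2 (fst (snd z), fst z)) has_derivative
        (\<lambda>h. F12 s (l s p) * fst (fst (snd h), fst h) + F22 s (l s p) * snd (fst (snd h), fst h))) (at (l s p, (s, p)))"
      by (rule has_derivative_compose[where g="case_prod F2" and f="\<lambda>z. (fst (snd z), fst z)"])
        (auto intro!: derivative_eq_intros F2)
    then have G: "(?G has_derivative (\<lambda>h. ?A (fst h) + ?B (snd h))) (at (l s p, (s, p)))"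
      by (auto intro!: derivative_eq_intros simp: fun_eq_iff)
    have "(case_prod l has_derivative (\<lambda>b. - ?A' (?B b))) (at (s, p))"
    proof (rule implicit_function_has_derivative[where A = ?A and A' = ?A' and B = ?B and G = ?G])
      show "(?G has_derivative (\<lambda>h. ?A (fst h) + ?B (snd h))) (at (case_prod l (s, p), (s, p)))"
        using G by simp
      show "bounded_linear ?A'" by (rule bounded_linear_divide)
      show "bounded_linear ?B"
        by (intro bounded_linear_intros)
      show "?A' (?A a) = a" for a using pos[of s "l s p"] by simp
      show "isCont (case_prod l) (s, p)" using lcont[OF p] by simp
      show "\<forall>\<^sub>F z in nhds (s, p). ?G (case_prod l z, z) = ?G (case_prod l (s, p), (s, p))"
        unfolding eventually_nhds using U p l by (intro exI[of _ ?U]) auto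
    qed
    then show ?thesis
      by (rule has_derivative_eq_rhs) (auto simp: fun_eq_iff l1_def l2_def diff_divide_distrib)
  qed
  have along: "((\<lambda>z. case_prod g (fst z, case_prod l z)) has_derivative
      (\<lambda>h. g1 * fst h + g2 * (l1 s p * fst h + l2 s p * snd h))) (at (s, p))"
    if p: "p \<in> {m<..<M}" and g: "(case_prod g has_derivative (\<lambda>h. g1 * fst h + g2 * snd h)) (at (s, l s p))"
    for g g1 g2 s p
  proof -
    have "((\<lambda>z. (fst z, case_prod l z)) has_derivative (\<lambda>h. (fst h, l1 s p * fst h + l2 s p * snd h))) (at (s, p))"
      by (intro derivative_intros dl[OF p])
    from has_derivative_compose[OF this, where g="case_prod g" and g'="\<lambda>h. g1 * fst h + g2 * snd h"] g
    show ?thesis by simp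
  qed
  \<comment> \<open>The envelope argument: the derivatives of \<open>l\<close> drop out because
    \<open>F2\<close> equals \<open>p\<close> along \<open>l\<close>. The first partials of
    \<open>H\<close> are thus \<open>F1\<close> along \<open>l\<close> and \<open>- l\<close>, which
    can be differentiated once more.\<close>
  have dH: "(case_prod H has_derivative (\<lambda>h. F1 s (l s p) * fst h + (- l s p) * snd h)) (at (s, p))"
    if p: "p \<in> {m<..<M}" for s p
  proof -
    have "((\<lambda>z. case_prod F (fst z, case_prod l z) - case_prod l z * snd z) has_derivative
       (\<lambda>h. (F1 s (l s p) * fst h + p * (l1 s p * fst h + l2 s p * snd h)) -
         (l s p * snd h + (l1 s p * fst h + l2 s p * snd h) * p))) (at (s, p))"
      by (rule has_derivative_eq_rhs[OF has_derivative_diff[OF along[OF p F] has_derivative_mult[OF dl[OF p] has_derivative_snd[OF has_derivative_ident]]]])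
        (simp add: l[OF p])
    then have "((\<lambda>z. case_prod F (fst z, case_prod l z) - case_prod l z * snd z) has_derivative
       (\<lambda>h. F1 s (l s p) * fst h + (- l s p) * snd h)) (at (s, p))"
      by (rule has_derivative_eq_rhs) (auto simp: fun_eq_iff algebra_simps)
    then show ?thesis
      by (rule has_derivative_transform_within_open[OF _ U]) (use p H in auto)
  qed
  define H11 where "H11 = (\<lambda>s p. F11 s (l s p) + F12 s (l s p) * l1 s p)"
  define H12 where "H12 = (\<lambda>s p. F12 s (l s p) * l2 s p)"
  have dH1: "(case_prod (\<lambda>s p. F1 s (l s p)) has_derivative (\<lambda>h. H11 s p * fst h + H12 s p * snd h)) (at (s, p))"
    if p: "p \<in> {m<..<M}" for s p
  proof -
    have "((\<lambda>z. case_prod F1 (fst z, case_prod l z)) has_derivative (\<lambda>h. H11 s p * fst h + H12 s p * snd h)) (at (s, p))"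
      by (rule has_derivative_eq_rhs[OF along[OF p F1]]) (auto simp: fun_eq_iff H11_def H12_def algebra_simps)
    then show ?thesis by (simp add: case_prod_unfold)
  qed
  have dH2: "(case_prod (\<lambda>s p. - l s p) has_derivative (\<lambda>h. (- l1 s p) * fst h + (- l2 s p) * snd h)) (at (s, p))"
    if p: "p \<in> {m<..<M}" for s p
    using has_derivative_minus[OF dl[OF p]] by (simp add: case_prod_unfold)
  have cl: "continuous_on ?U (case_prod l)"
    using lcont by (intro continuous_at_imp_continuous_on) auto
  have ccomp: "continuous_on ?U (\<lambda>z. case_prod g (fst z, case_prod l z))" if "continuous_on UNIV (case_prod g)" for g :: "real \<Rightarrow> real \<Rightarrow> real"
    by (rule continuous_on_compose2[OF that]) (auto intro!: continuous_intros cl)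
  have c: "continuous_on ?U (\<lambda>z. F11 (fst z) (case_prod l z))" "continuous_on ?U (\<lambda>z. F12 (fst z) (case_prod l z))"
    "continuous_on ?U (\<lambda>z. F22 (fst z) (case_prod l z))"
    using ccomp[OF cont(1)] ccomp[OF cont(2)] ccomp[OF cont(3)] by simp_all
  have cc: "continuous_on ?U (\<lambda>z. l1 (fst z) (snd z))" "continuous_on ?U (\<lambda>z. l2 (fst z) (snd z))"
    unfolding l1_def l2_def using pos
    by (auto intro!: continuous_intros c[unfolded case_prod_unfold] simp: less_imp_neq[THEN not_sym])
  show "C2_on (UNIV \<times> {m<..<M}) (case_prod H)"
  proof (rule C2_on_prodI)
    show "continuous_on ?U (case_prod H11)" "continuous_on ?U (case_prod H12)"
      "continuous_on ?U (case_prod (\<lambda>s p. - l1 s p))" "continuous_on ?U (case_prod (\<lambda>s p. - l2 s p))"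
      unfolding H11_def H12_def case_prod_unfold
      by (auto intro!: continuous_intros c[unfolded case_prod_unfold] cc)
  next
    fix x assume "x \<in> ?U"
    then obtain s p where x: "x = (s, p)" and p: "p \<in> {m<..<M}" by auto
    show "(case_prod H has_derivative (\<lambda>h. case_prod (\<lambda>s p. F1 s (l s p)) x * fst h + case_prod (\<lambda>s p. - l s p) x * snd h)) (at x)"
      using dH[OF p] by (simp add: x)
    show "(case_prod (\<lambda>s p. F1 s (l s p)) has_derivative (\<lambda>h. case_prod H11 x * fst h + case_prod H12 x * snd h)) (at x)"
      using dH1[OF p] by (simp add: x)
    show "(case_prod (\<lambda>s p. - l s p) has_derivative (\<lambda>h. case_prod (\<lambda>s p. - l1 s p) x * fst h + case_prod (\<lambda>s p. - l2 s p) x * snd h)) (at x)"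
      using dH2[OF p] by (simp add: x)
  qed
  assume p: "p \<in> {m<..<M}"
  have sp: "(s, p) \<in> ?U" using p by simp
  have dH': "(case_prod H has_derivative (\<lambda>h. F1 s (l s p) * fst h + (- l s p) * snd h)) (at (s, p))" if "(s, p) \<in> ?U" for s p
    using that dH by blast
  note rules = second_partial_derivatives[OF U sp dH' dH1[OF p] dH2[OF p]]
  have second: "pd1 (pd1 H) s p = H11 s p" "pd2 (pd1 H) s p = H12 s p" "pd2 (pd2 H) s p = - l2 s p"
    by (rule rules; assumption)+
  show "pd1 (pd1 H) s p = F11 s (l s p) - (F12 s (l s p))\<^sup>2 / F22 s (l s p)"
    unfolding second(1) H11_def l1_def by (simp add: power2_eq_square)
  show "pd2 (pd1 H) s p = F12 s (l s p) / F22 s (l s p)"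
    unfolding second(2) H12_def l2_def by simp
  show "pd2 (pd2 H) s p = - (1 / F22 s (l s p))"
    unfolding second(3) l2_def by simp
qed

section \<open>The slicing support function as a Legendre transform and its Monge-Ampere
  determinant\<close>

theorem theorem6:
  fixes K :: "(real^3) set" and \<nu> e1 e2 :: "real^3" and m M :: real
    and u :: "real \<Rightarrow> real^3" and F H :: "real \<Rightarrow> real \<Rightarrow> real"
  assumes "strictly_convex_body K"
    and "C2_surface (frontier K)"
    and "\<And>x. x \<in> frontier K \<Longrightarrow> gaussian_curvature (frontier K) x > 0"
    and "norm \<nu> = 1"
    and "norm e1 = 1" and "norm e2 = 1" and "e1 \<bullet> e2 = 0"
    and "e1 \<bullet> \<nu> = 0" and "e2 \<bullet> \<nu> = 0" and "cross3 e1 e2 = \<nu>"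
    and "m = (INF x\<in>K. x \<bullet> \<nu>)" and "M = (SUP x\<in>K. x \<bullet> \<nu>)"
    and "u = (\<lambda>\<theta>. cos \<theta> *\<^sub>R e1 + sin \<theta> *\<^sub>R e2)"
    and "F = (\<lambda>\<theta> l. support_function K (u \<theta> + l *\<^sub>R \<nu>))"
    and "H = (\<lambda>\<theta> p. real_of_ereal (slicing_support_function K \<nu> (u \<theta>) p))"
  shows "C2_on UNIV (\<lambda>(\<theta>, l). F \<theta> l)
    \<and> C2_on (UNIV \<times> {m<..<M}) (\<lambda>(\<theta>, p). H \<theta> p)
    \<and> (\<forall>\<theta>. \<forall>p\<in>{m<..<M}.
        slicing_support_function K \<nu> (u \<theta>) p = ereal (H \<theta> p)
      \<and> ereal (H \<theta> p) = (INF l. ereal (F \<theta> l - l * p))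
      \<and> (\<exists>!l. is_arg_min (\<lambda>l. F \<theta> l - l * p) (\<lambda>_. True) l)
      \<and> monge_ampere_op H \<theta> p =
          (pd1 (pd1 H) \<theta> p + H \<theta> p) * pd2 (pd2 H) \<theta> p - (pd2 (pd1 H) \<theta> p)\<^sup>2
      \<and> (\<forall>l. is_arg_min (\<lambda>l. F \<theta> l - l * p) (\<lambda>_. True) l \<longrightarrow>
            monge_ampere_op H \<theta> p =
              - ((pd1 (pd1 F) \<theta> l + F \<theta> l - l * pd2 F \<theta> l) / pd2 (pd2 F) \<theta> l)
          \<and> monge_ampere_op H \<theta> p =
              - ((pd1 (pd1 F) \<theta> l + F \<theta> l - l * p) / pd2 (pd2 F) \<theta> l))
      \<and> monge_ampere_op H \<theta> p < 0)"
proof -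
  have K: "strictly_convex_body K" by fact
  then have cb: "convex_body K" by (simp add: strictly_convex_body_def)
  define u' where "u' = (\<lambda>s. - sin s *\<^sub>R e1 + cos s *\<^sub>R e2)"
  define x where "x = (\<lambda>s t. support_point K (u s + t *\<^sub>R \<nu>))"
  define F1 F2 where "F1 = (\<lambda>s t. x s t \<bullet> u' s)" and "F2 = (\<lambda>s t. x s t \<bullet> \<nu>)"
  obtain F11 F12 F22 where
    dF: "\<forall>s t. (case_prod F has_derivative (\<lambda>h. F1 s t * fst h + F2 s t * snd h)) (at (s, t))"
    and dF1: "\<forall>s t. (case_prod F1 has_derivative (\<lambda>h. F11 s t * fst h + F12 s t * snd h)) (at (s, t))"
    and dF2: "\<forall>s t. (case_prod F2 has_derivative (\<lambda>h. F12 s t * fst h + F22 s t * snd h)) (at (s, t))"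
    and cont: "continuous_on UNIV (case_prod F11)" "continuous_on UNIV (case_prod F12)"
      "continuous_on UNIV (case_prod F22)"
    and F22: "\<forall>s t. F22 s t > 0" and F11: "\<forall>s t. F11 s t + F s t - t * F2 s t > 0"
    using support_function_cylindrical[OF assms(1-9,13) u'_def x_def assms(14) F1_def F2_def] .
  note dF = dF[rule_format] and dF1 = dF1[rule_format] and dF2 = dF2[rule_format]
    and F22 = F22[rule_format] and F11 = F11[rule_format]
  have mono: "strict_mono (F2 s)" for s
  proof (rule strict_monoI)
    fix a b :: real assume "a < b"
    then show "F2 s a < F2 s b"
      by (rule DERIV_pos_imp_increasing) (use partial_derivatives_curried(2)[OF dF2] F22 in blast)
  qed
  have M: "M = support_point K \<nu> \<bullet> \<nu>"
    using support_function_eq[OF cb, of \<nu>] assms(12) by (simp add: support_function_def)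
  obtain y where y: "y \<in> K" "y \<bullet> \<nu> = m"
  proof -
    have "continuous_on K (\<lambda>z. z \<bullet> \<nu>)" by (intro continuous_intros)
    then obtain y where y: "y \<in> K" "\<forall>z\<in>K. y \<bullet> \<nu> \<le> z \<bullet> \<nu>"
      using continuous_attains_inf[OF convex_bodyD(1,2)[OF cb]] by blast
    then have "(INF x\<in>K. x \<bullet> \<nu>) = y \<bullet> \<nu>" by (intro cInf_eq_minimum) auto
    then show ?thesis using that y assms(11) by simp
  qed
  have F_ge: "z \<bullet> u s + t * (z \<bullet> \<nu>) \<le> F s t" if "z \<in> K" for z s t
    using support_point(2)[OF cb that, of "u s + t *\<^sub>R \<nu>"]
    by (simp add: assms(14) support_function_eq[OF cb] inner_simps)
  have x_eq: "x s t \<bullet> u s = F s t - t * F2 s t" for s t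
    by (simp add: assms(14) F2_def x_def support_function_eq[OF cb] inner_simps)
  have crit: "F2 s t = p" if "\<And>t'. F s t - t * p \<le> F s t' - t' * p" for s t p
  proof -
    have "((\<lambda>t. F s t - t * p) has_real_derivative F2 s t - p) (at t)"
      by (auto intro!: derivative_eq_intros partial_derivatives_curried(2)[OF dF])
    then have "F2 s t - p = 0" by (rule DERIV_local_min[of _ _ _ 1]) (use that in auto)
    then show ?thesis by simp
  qed
  \<comment> \<open>Testing the support function on a highest and a lowest point of \<open>K\<close>
    in direction \<open>\<nu>\<close> bounds the objective below by lines of slopes
    \<open>M - p\<close> and \<open>- (p - m)\<close>, one rising and one falling because
    \<open>p\<close> lies strictly between \<open>m\<close> and \<open>M\<close>.\<close>
  have min_ex: "\<exists>t. \<forall>t'. F s t - t * p \<le> F s t' - t' * p" if p: "p \<in> {m<..<M}" for s p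
  proof -
    have "continuous_on UNIV (\<lambda>t. F s t - t * p)"
      by (intro continuous_at_imp_continuous_on ballI DERIV_isCont[where D="F2 s _ - p"])
        (auto intro!: derivative_eq_intros partial_derivatives_curried(2)[OF dF])
    moreover have "0 < M - p" "0 < p - m" using p by auto
    moreover have "support_point K \<nu> \<bullet> u s + (M - p) * t \<le> F s t - t * p" for t
      using F_ge[OF support_point(1)[OF cb], of \<nu> s t] by (simp add: M algebra_simps)
    moreover have "y \<bullet> u s - (p - m) * t \<le> F s t - t * p" for t
      using F_ge[OF y(1), of s t] by (simp add: y(2) algebra_simps)
    ultimately obtain t where "\<forall>t'. F s t - t * p \<le> F s t' - t' * p"
      by (rule continuous_attains_inf_coercive) blast
    then show ?thesis by blast
  qed
  \<comment> \<open>For the converse direction, a minimiser exists and is itself critical;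
    injectivity of \<open>F2 s\<close> identifies it with the given critical point.\<close>
  have argmin: "is_arg_min (\<lambda>t. F s t - t * p) (\<lambda>_. True) t \<longleftrightarrow> F2 s t = p"
    if p: "p \<in> {m<..<M}" for s p t
  proof
    assume "is_arg_min (\<lambda>t. F s t - t * p) (\<lambda>_. True) t"
    then show "F2 s t = p" by (intro crit) (auto simp: is_arg_min_def not_less)
  next
    assume *: "F2 s t = p"
    obtain t0 where t0: "\<forall>t'. F s t0 - t0 * p \<le> F s t' - t' * p" using min_ex[OF p] by blast
    then have "F2 s t0 = p" by (intro crit) blast
    with * have "t = t0" using strict_mono_eq[OF mono] by metis
    with t0 show "is_arg_min (\<lambda>t. F s t - t * p) (\<lambda>_. True) t" by (auto simp: is_arg_min_def not_less)
  qed
  define l where "l = (\<lambda>s p. SOME t. F2 s t = p)"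
  have l: "F2 s (l s p) = p" if p: "p \<in> {m<..<M}" for s p
  proof -
    obtain t where "\<forall>t'. F s t - t * p \<le> F s t' - t' * p" using min_ex[OF p] by blast
    then have "F2 s t = p" by (intro crit) blast
    then show ?thesis unfolding l_def by (rule someI)
  qed
  have l_unique: "t = l s p" if "p \<in> {m<..<M}" "F2 s t = p" for s p t
    using that l[OF that(1), of s] strict_mono_eq[OF mono] by metis
  have l_min: "F s (l s p) - l s p * p \<le> F s t - t * p" if "p \<in> {m<..<M}" for s p t
    using argmin[OF that, of s "l s p"] l[OF that] by (auto simp: is_arg_min_def not_less)
  \<comment> \<open>Points of the slice satisfy the upper bound by \<open>F_ge\<close>, and equality
    is attained at \<open>x s (l s p)\<close>, which has height \<open>p\<close> since
    \<open>F2\<close> is the height of \<open>x\<close>. The value is finite, so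
    \<open>real_of_ereal\<close> in the definition of \<open>H\<close> loses nothing.\<close>
  have slice: "slicing_support_function K \<nu> (u s) p = ereal (F s (l s p) - l s p * p)"
    if p: "p \<in> {m<..<M}" for s p
    unfolding slicing_support_function_def
  proof (rule antisym)
    show "(SUP z\<in>{z\<in>K. z \<bullet> \<nu> = p}. ereal (z \<bullet> u s)) \<le> ereal (F s (l s p) - l s p * p)"
      using F_ge[of _ s "l s p"] by (intro SUP_least) (auto simp: le_diff_eq)
    show "ereal (F s (l s p) - l s p * p) \<le> (SUP z\<in>{z\<in>K. z \<bullet> \<nu> = p}. ereal (z \<bullet> u s))"
    proof (rule SUP_upper2)
      show "x s (l s p) \<in> {z\<in>K. z \<bullet> \<nu> = p}"
        using l[OF p, of s] support_point(1)[OF cb] by (simp add: F2_def x_def)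
    qed (simp add: x_eq l[OF p])
  qed
  have H: "H s p = F s (l s p) - l s p * p" if "p \<in> {m<..<M}" for s p
    by (simp add: assms(15) slice[OF that])
  note rules = partial_legendre_transform[where m = m and M = M, OF dF dF1 dF2 cont F22 l H]
  have legendre: "C2_on (UNIV \<times> {m<..<M}) (case_prod H)" by (rule rules; assumption)
  have pdH: "pd1 (pd1 H) s p = F11 s (l s p) - (F12 s (l s p))\<^sup>2 / F22 s (l s p)"
    "pd2 (pd1 H) s p = F12 s (l s p) / F22 s (l s p)" "pd2 (pd2 H) s p = - (1 / F22 s (l s p))"
    if "p \<in> {m<..<M}" for s p
    by (rule rules; (assumption | rule that))+
  have C2F: "C2_on UNIV (case_prod F)"
  proof (rule C2_on_prodI)
    fix z :: "real \<times> real"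
    show "(case_prod F has_derivative (\<lambda>h. case_prod F1 z * fst h + case_prod F2 z * snd h)) (at z)"
      "(case_prod F1 has_derivative (\<lambda>h. case_prod F11 z * fst h + case_prod F12 z * snd h)) (at z)"
      "(case_prod F2 has_derivative (\<lambda>h. case_prod F12 z * fst h + case_prod F22 z * snd h)) (at z)"
      using dF[of "fst z" "snd z"] dF1[of "fst z" "snd z"] dF2[of "fst z" "snd z"]
      by (simp_all add: case_prod_unfold)
  qed (rule cont)+
  have pdF: "pd1 (pd1 F) s t = F11 s t" "pd2 F s t = F2 s t" "pd2 (pd2 F) s t = F22 s t" for s t
    using second_partial_derivatives[OF open_UNIV UNIV_I dF dF1 dF2] partial_derivatives_curried(4)[OF dF]
    by auto
  have det: "monge_ampere_op H s p = (pd1 (pd1 H) s p + H s p) * pd2 (pd2 H) s p - (pd2 (pd1 H) s p)\<^sup>2" for s p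
    by (simp add: monge_ampere_op_def det_2 power2_eq_square)
  \<comment> \<open>The contributions of \<open>(F12 s (l s p))\<^sup>2\<close> from the two
    products cancel, leaving \<open>- (F11 s (l s p) + H s p) / F22 s (l s p)\<close>.\<close>
  have MA: "monge_ampere_op H s p = - ((F11 s (l s p) + F s (l s p) - l s p * p) / F22 s (l s p))"
    if p: "p \<in> {m<..<M}" for s p
    using F22[of s "l s p"] unfolding det pdH[OF p] H[OF p]
    by (simp add: field_simps power2_eq_square)
  show ?thesis
  proof (intro conjI allI ballI)
    show "C2_on UNIV (\<lambda>(\<theta>, l). F \<theta> l)" by (rule C2F)
    show "C2_on (UNIV \<times> {m<..<M}) (\<lambda>(\<theta>, p). H \<theta> p)" by (rule legendre)
    fix \<theta> p assume p: "p \<in> {m<..<M}"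
    show "slicing_support_function K \<nu> (u \<theta>) p = ereal (H \<theta> p)" by (simp add: slice[OF p] H[OF p])
    show "ereal (H \<theta> p) = (INF t. ereal (F \<theta> t - t * p))"
      unfolding H[OF p]
      by (rule antisym[OF INF_greatest INF_lower2[of "l \<theta> p"]]) (use l_min[OF p] in auto)
    show "\<exists>!t. is_arg_min (\<lambda>t. F \<theta> t - t * p) (\<lambda>_. True) t"
      unfolding argmin[OF p] using l[OF p] l_unique[OF p] by blast
    show "monge_ampere_op H \<theta> p = (pd1 (pd1 H) \<theta> p + H \<theta> p) * pd2 (pd2 H) \<theta> p - (pd2 (pd1 H) \<theta> p)\<^sup>2"
      by (rule det)
    show "monge_ampere_op H \<theta> p < 0"
      using F11[of \<theta> "l \<theta> p"] F22[of \<theta> "l \<theta> p"] by (simp add: MA[OF p] l[OF p])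
    fix t
    show "is_arg_min (\<lambda>t. F \<theta> t - t * p) (\<lambda>_. True) t \<longrightarrow>
        monge_ampere_op H \<theta> p = - ((pd1 (pd1 F) \<theta> t + F \<theta> t - t * pd2 F \<theta> t) / pd2 (pd2 F) \<theta> t) \<and>
        monge_ampere_op H \<theta> p = - ((pd1 (pd1 F) \<theta> t + F \<theta> t - t * p) / pd2 (pd2 F) \<theta> t)"
    proof
      assume "is_arg_min (\<lambda>t. F \<theta> t - t * p) (\<lambda>_. True) t"
      then have "t = l \<theta> p" using argmin[OF p] l_unique[OF p] by blast
      then show "monge_ampere_op H \<theta> p = - ((pd1 (pd1 F) \<theta> t + F \<theta> t - t * pd2 F \<theta> t) / pd2 (pd2 F) \<theta> t) \<and>
        monge_ampere_op H \<theta> p = - ((pd1 (pd1 F) \<theta> t + F \<theta> t - t * p) / pd2 (pd2 F) \<theta> t)"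
        by (simp add: pdF MA[OF p] l[OF p])
    qed
  qed
qed

end
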